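(* For every $\varepsilon\in(0,2/5]$ there exists a real number $p_0(\varepsilon)>0$ such that the following holds. Let $\psi,\theta:\mathbb{N}\to\mathbb{R}_{\geqslant 0}$ be finitely supported, let $V_\psi=\operatorname{supp}\psi$, $W_\theta=\operatorname{supp}\theta$, and $$\mathcal{P}_{\psi,\theta}:=\{p \text{ prime}:\ \exists\,(v,w)\in V_\psi\times W_\theta\ \text{such that}\ p\mid vw\},\qquad P_{\psi,\theta}(\varepsilon):=p_0(\varepsilon)+\big|\mathcal{P}_{\psi,\theta}\cap[1,p_0(\varepsilon)]\big|.$$ Let $f,g:\mathbb{N}\to\mathbb{R}_{\geqslant 0}$ be multiplicative functions with $(1\star f)(n)\leqslant n$ and $(1\star g)(n)\leqslant n$ for all $n\geqslant 1$. Let $t\geqslant 1$, $C\in\mathbb{R}$, let $V\subset V_\psi$, $W\subset W_\theta$, and suppose that $\mathcal{E}\subset\mathcal{E}_{\psi,\theta}^{t,C}\cap(V\times W)$. Then $$\mu_{\psi,\theta}^{f,g}(\mathcal{E})\leqslant 1000^{P_{\psi,\theta}(\varepsilon)}\big(\mu_\psi^f(V)\,\mu_\theta^g(W)\,e^{-Ct}\big)^{\frac12+\varepsilon}.$$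
   Context: $\mathbb{N}$ denotes the positive integers; $p$ always denotes a prime. Dirichlet convolution: $(1\star f)(n)=\sum_{d\mid n}f(d)$. For $v\in\mathbb{N}$, $\mu_\psi^f(v):=\frac{f(v)\psi(v)}{v}$; for $V\subset\mathbb{N}$, $\mu_\psi^f(V):=\sum_{v\in V}\mu_\psi^f(v)$ (and similarly $\mu_\theta^g$); for $\mathcal{E}\subset\mathbb{N}\times\mathbb{N}$, $\mu_{\psi,\theta}^{f,g}(\mathcal{E}):=\sum_{(v,w)\in\mathcal{E}}\mu_\psi^f(v)\mu_\theta^g(w)$. For $t\geqslant 1$ and $C\in\mathbb{R}$, $$\mathcal{E}_{\psi,\theta}^{t,C}:=\Big\{(v,w)\in V_\psi\times W_\theta:\ D_{\psi,\theta}(v,w)\leqslant 1,\ \sum_{\substack{p\mid \frac{vw}{\gcd(v,w)^2}\\ p\geqslant t}}\frac1p\geqslant C\Big\},\qquad D_{\psi,\theta}(v,w)=\frac{\max(w\psi(v),\,v\theta(w))}{\gcd(v,w)}.$$ *)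

theory Defs
  imports "HOL-Analysis.Analysis" "HOL-Computational_Algebra.Primes"
begin

text \<open>Functions on the positive integers are represented by functions on \<^typ>\<open>nat\<close>
  whose value at \<open>0\<close> is never used: it is excluded from supports and from all hypotheses.\<close>

definition pos_supp :: "(nat \<Rightarrow> real) \<Rightarrow> nat set" where
  "pos_supp \<psi> = {v. v > 0 \<and> \<psi> v \<noteq> 0}"

definition nonneg_fun :: "(nat \<Rightarrow> real) \<Rightarrow> bool" where
  "nonneg_fun f \<longleftrightarrow> (\<forall>n>0. f n \<ge> 0)"

definition multiplicative_fun :: "(nat \<Rightarrow> real) \<Rightarrow> bool" where
  "multiplicative_fun f \<longleftrightarrow>
     f 1 = 1 \<and> (\<forall>m n. m > 0 \<longrightarrow> n > 0 \<longrightarrow> coprime m n \<longrightarrow> f (m * n) = f m * f n)"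

definition one_conv :: "(nat \<Rightarrow> real) \<Rightarrow> nat \<Rightarrow> real" where
  "one_conv f n = (\<Sum>d | d dvd n. f d)"

definition mu_pt :: "(nat \<Rightarrow> real) \<Rightarrow> (nat \<Rightarrow> real) \<Rightarrow> nat \<Rightarrow> real" where
  "mu_pt f \<psi> v = f v * \<psi> v / real v"

text \<open>Infinite sums, since the measures are defined on arbitrary sets; for finitely supported
  \<open>\<psi>\<close>, \<open>\<theta>\<close> only finitely many terms are nonzero (the term at \<open>v = 0\<close> vanishes because
  \<open>x / 0 = 0\<close>).\<close>

definition mu :: "(nat \<Rightarrow> real) \<Rightarrow> (nat \<Rightarrow> real) \<Rightarrow> nat set \<Rightarrow> real" where
  "mu f \<psi> V = (\<Sum>\<^sub>\<infinity>v\<in>V. mu_pt f \<psi> v)"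

definition mu2 ::
  "(nat \<Rightarrow> real) \<Rightarrow> (nat \<Rightarrow> real) \<Rightarrow> (nat \<Rightarrow> real) \<Rightarrow> (nat \<Rightarrow> real) \<Rightarrow> (nat \<times> nat) set \<Rightarrow> real" where
  "mu2 f g \<psi> \<theta> E = (\<Sum>\<^sub>\<infinity>(v, w)\<in>E. mu_pt f \<psi> v * mu_pt g \<theta> w)"

definition D :: "(nat \<Rightarrow> real) \<Rightarrow> (nat \<Rightarrow> real) \<Rightarrow> nat \<Rightarrow> nat \<Rightarrow> real" where
  "D \<psi> \<theta> v w = max (real w * \<psi> v) (real v * \<theta> w) / real (gcd v w)"

text \<open>The natural-number division below is exact.\<close>

definition edge_set ::
  "(nat \<Rightarrow> real) \<Rightarrow> (nat \<Rightarrow> real) \<Rightarrow> real \<Rightarrow> real \<Rightarrow> (nat \<times> nat) set" where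
  "edge_set \<psi> \<theta> t C =
     {(v, w) \<in> pos_supp \<psi> \<times> pos_supp \<theta>.
        D \<psi> \<theta> v w \<le> 1 \<and>
        (\<Sum>p | prime p \<and> p dvd (v * w) div (gcd v w)^2 \<and> real p \<ge> t. 1 / real p) \<ge> C}"

definition prime_set :: "(nat \<Rightarrow> real) \<Rightarrow> (nat \<Rightarrow> real) \<Rightarrow> nat set" where
  "prime_set \<psi> \<theta> = {p. prime p \<and> (\<exists>(v, w) \<in> pos_supp \<psi> \<times> pos_supp \<theta>. p dvd v * w)}"

text \<open>The exponent \<open>P\<^sub>\<psi>\<^sub>,\<^sub>\<theta>(\<epsilon>)\<close>; it depends on \<open>\<epsilon>\<close> only through \<open>p\<^sub>0 = p\<^sub>0(\<epsilon>)\<close>.\<close>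

definition P_exp :: "(nat \<Rightarrow> real) \<Rightarrow> (nat \<Rightarrow> real) \<Rightarrow> real \<Rightarrow> real" where
  "P_exp \<psi> \<theta> p0 = p0 + real (card {p \<in> prime_set \<psi> \<theta>. 1 \<le> real p \<and> real p \<le> p0})"

end

theory Submission
  imports Defs
begin

text \<open>Put \<open>q = 1/2 + \<epsilon>\<close> and weight an edge by the exponential of \<open>q t\<close> times the sum of \<open>1/p\<close> over the
  primes \<open>p \<ge> t\<close> at which its endpoints have different valuations. By Chernoff's argument it
  suffices to bound the weighted mass of the edges by \<open>K (\<mu>(V) \<mu>(W))\<^sup>q\<close>, which is done by induction on
  the number of primes involved. Splitting by the valuations \<open>(i, j)\<close> at \<open>p\<close> and removing \<open>p\<close>, the
  induction hypothesis bounds each piece by \<open>K (\<mu>(V\<^sub>i) \<mu>(W\<^sub>j))\<^sup>q\<close> times a kernel decaying like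
  \<open>p\<close> to the power \<open>- (1 - q) \<bar>i - j\<bar>\<close>. For a small prime, Schur's test costs a factor \<open>1000\<close>. If all
  primes are large and the bound fails, each \<open>p\<close> must have a value \<open>k\<^sub>p\<close> such that both endpoints have
  valuation \<open>k\<^sub>p\<close> on all but \<open>O(1/p)\<close> of the mass, and both deviate
  from \<open>k\<^sub>p\<close> only on a summable proportion \<open>O(1/p\<^sup>2\<^sup>q)\<close>. Half of the mass then lies on edges of bounded
  weight without simultaneous deviations. For those, with \<open>N\<close> the product of the \<open>p\<close> to the power
  \<open>k\<^sub>p\<close>, a count of paths of length two in a subgraph of large minimum degree gives \<open>\<mu>(E)\<^sup>2 \<le> 16 \<mu>(V) \<mu>(W)\<close>,
  which together with \<open>\<mu>(E) \<le> \<mu>(V) \<mu>(W)\<close> contradicts the failure of the bound.\<close>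

section \<open>Concentration for a single prime\<close>

text \<open>The truncated differences \<open>(i - j) + (j - i)\<close> encode |i - j|. On either
  side of \<open>i\<close> the distance is injective with positive values, so each half is dominated
  by the geometric series starting at \<open>z\<close>.\<close>

lemma sum_power_dist_le:
  fixes z :: real
  assumes "finite I" "0 \<le> z" "z < 1"
  shows "(\<Sum>j\<in>I - {i}. z ^ ((i - j) + (j - i))) \<le> 2 * (z / (1 - z))"
proof -
  have geo: "(\<Sum>j\<in>J. z ^ h j) \<le> z / (1 - z)"
    if J: "finite J" "inj_on h J" "\<And>j. j \<in> J \<Longrightarrow> h j \<ge> (1::nat)" for J :: "nat set" and h
  proof -
    have "(\<Sum>j\<in>J. z ^ h j) = (\<Sum>n\<in>h ` J. z ^ n)"
      using J(2) by (simp add: sum.reindex)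
    also have "\<dots> \<le> (\<Sum>n. z ^ Suc n)"
    proof -
      have inj: "inj_on (\<lambda>n. n - 1) (h ` J)"
        using J(3) by (intro inj_on_diff_nat) auto
      have "(\<Sum>n\<in>h ` J. z ^ n) = (\<Sum>n\<in>h ` J. z ^ Suc (n - 1))"
        using J(3) by (intro sum.cong refl) (auto simp: Suc_le_eq simp del: power_Suc)
      also have "\<dots> = (\<Sum>n\<in>(\<lambda>n. n - 1) ` (h ` J). z ^ Suc n)"
        by (simp only: sum.reindex[OF inj] o_def)
      also have "\<dots> \<le> (\<Sum>n. z ^ Suc n)"
        using assms J(1) by (intro sum_le_suminf) (auto simp: summable_mult summable_geometric)
      finally show ?thesis .
    qed
    also have "\<dots> = z / (1 - z)"
      using assms suminf_mult[of "\<lambda>n. z ^ n" z] by (simp add: summable_geometric suminf_geometric)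
    finally show ?thesis .
  qed
  have split: "I - {i} = {j \<in> I. j < i} \<union> {j \<in> I. i < j}" by auto
  have "(\<Sum>j\<in>I - {i}. z ^ ((i - j) + (j - i)))
      = (\<Sum>j\<in>{j \<in> I. j < i}. z ^ ((i - j) + (j - i))) + (\<Sum>j\<in>{j \<in> I. i < j}. z ^ ((i - j) + (j - i)))"
    unfolding split using assms(1) by (intro sum.union_disjoint) auto
  also have "\<dots> \<le> z / (1 - z) + z / (1 - z)"
    using assms(1) by (intro add_mono geo) (auto simp: inj_on_def)
  finally show ?thesis by simp
qed

text \<open>Symmetry makes the row bound \<open>B\<close> a column bound as well, so after AM-GM on
  each product \<open>u i * v j\<close> the two halves contribute at most \<open>B * s / 2\<close>
  each.\<close>

lemma schur_test:
  fixes u v :: "nat \<Rightarrow> real" and k :: "nat \<Rightarrow> nat \<Rightarrow> real"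
  assumes "finite I" "\<And>i j. k i j \<ge> 0" "\<And>i j. k i j = k j i"
    and row: "\<And>i. i \<in> I \<Longrightarrow> (\<Sum>j\<in>I. k i j) \<le> B"
    and u2: "(\<Sum>i\<in>I. (u i)\<^sup>2) \<le> s" and v2: "(\<Sum>i\<in>I. (v i)\<^sup>2) \<le> s" and "B \<ge> 0"
  shows "(\<Sum>i\<in>I. \<Sum>j\<in>I. u i * v j * k i j) \<le> B * s"
proof -
  have "(\<Sum>i\<in>I. \<Sum>j\<in>I. u i * v j * k i j)
      \<le> (\<Sum>i\<in>I. \<Sum>j\<in>I. ((u i)\<^sup>2 / 2 + (v j)\<^sup>2 / 2) * k i j)"
  proof (intro sum_mono mult_right_mono assms)
    fix i j show "u i * v j \<le> (u i)\<^sup>2 / 2 + (v j)\<^sup>2 / 2"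
      using sum_squares_bound[of "u i" "v j"] by simp
  qed
  also have "\<dots> = (\<Sum>i\<in>I. \<Sum>j\<in>I. (u i)\<^sup>2 / 2 * k i j) + (\<Sum>i\<in>I. \<Sum>j\<in>I. (v j)\<^sup>2 / 2 * k i j)"
    by (simp add: distrib_right sum.distrib)
  also have "(\<Sum>i\<in>I. \<Sum>j\<in>I. (v j)\<^sup>2 / 2 * k i j) = (\<Sum>j\<in>I. \<Sum>i\<in>I. (v j)\<^sup>2 / 2 * k j i)"
    using assms(3) by (subst sum.swap) simp
  also have "(\<Sum>i\<in>I. \<Sum>j\<in>I. (u i)\<^sup>2 / 2 * k i j) \<le> (\<Sum>i\<in>I. (u i)\<^sup>2 / 2 * B)"
    unfolding sum_distrib_left[symmetric] by (intro sum_mono mult_left_mono row) auto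
  also have "(\<Sum>j\<in>I. \<Sum>i\<in>I. (v j)\<^sup>2 / 2 * k j i) \<le> (\<Sum>j\<in>I. (v j)\<^sup>2 / 2 * B)"
    unfolding sum_distrib_left[symmetric] by (intro sum_mono mult_left_mono row) auto
  also have "(\<Sum>i\<in>I. (u i)\<^sup>2 / 2 * B) + (\<Sum>j\<in>I. (v j)\<^sup>2 / 2 * B)
      = B * ((\<Sum>i\<in>I. (u i)\<^sup>2) + (\<Sum>i\<in>I. (v i)\<^sup>2)) / 2"
    by (simp add: sum_distrib_left sum_divide_distrib mult_ac add_divide_distrib distrib_left)
  also have "\<dots> \<le> B * (s + s) / 2"
    using assms by (intro divide_right_mono mult_left_mono add_mono) auto
  finally show ?thesis by simp
qed

text \<open>In the applications \<open>z\<close> is \<open>p powr - (1 - q)\<close>. The constant 3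
  absorbs the factor, at most e, that the weight gains when the valuations at \<open>p\<close>
  differ.\<close>

definition kern :: "real \<Rightarrow> nat \<Rightarrow> nat \<Rightarrow> real" where
  "kern z i j = (if i = j then 1 else 3 * z ^ ((i - j) + (j - i)))"

lemma kern_nonneg: "z \<ge> 0 \<Longrightarrow> kern z i j \<ge> 0"
  and kern_sym: "kern z i j = kern z j i"
  by (auto simp: kern_def add.commute)

lemma sum_kern_offdiag_le:
  assumes "finite I" "0 \<le> z" "z < 1"
  shows "(\<Sum>j\<in>I - {i}. kern z i j) \<le> 6 * (z / (1 - z))"
proof -
  have "(\<Sum>j\<in>I - {i}. kern z i j) = 3 * (\<Sum>j\<in>I - {i}. z ^ ((i - j) + (j - i)))"
    unfolding sum_distrib_left by (intro sum.cong) (auto simp: kern_def)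
  thus ?thesis using sum_power_dist_le[OF assms, of i] by simp
qed

lemma sum_kern_le:
  assumes "finite I" "0 \<le> z" "z < 1"
  shows "(\<Sum>j\<in>I. kern z i j) \<le> 1 + 6 * (z / (1 - z))"
proof -
  have "(\<Sum>j\<in>I. kern z i j) \<le> (\<Sum>j\<in>insert i (I - {i}). kern z i j)"
    using assms by (intro sum_mono2) (auto simp: kern_nonneg)
  also have "\<dots> = kern z i i + (\<Sum>j\<in>I - {i}. kern z i j)"
    using assms(1) by (subst sum.insert) auto
  finally show ?thesis using sum_kern_offdiag_le[OF assms, of i] by (simp add: kern_def)
qed

text \<open>Since 2 q - 1 is nonnegative, one factor \<open>\<alpha> i\<close> can be kept and the
  remaining power bounded by \<open>m powr (2 * q - 1)\<close>.\<close>

lemma sum_powr_square_le: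
  fixes \<alpha> :: "nat \<Rightarrow> real"
  assumes "finite I" "\<And>i. i \<in> I \<Longrightarrow> \<alpha> i \<ge> 0" "(\<Sum>i\<in>I. \<alpha> i) \<le> m" "q \<ge> 1 / 2"
  shows "(\<Sum>i\<in>I. (\<alpha> i powr q)\<^sup>2) \<le> m powr (2 * q)"
proof -
  have m: "m \<ge> 0" using assms by (meson order_trans sum_nonneg)
  have le: "\<alpha> i \<le> m" if "i \<in> I" for i
    using member_le_sum[of i I \<alpha>] assms that by auto
  have *: "x powr (2 * q) = x * x powr (2 * q - 1)" if "x \<ge> 0" for x :: real
    using that powr_mult_base[of x "2 * q - 1"] by simp
  have "(\<Sum>i\<in>I. (\<alpha> i powr q)\<^sup>2) = (\<Sum>i\<in>I. \<alpha> i * \<alpha> i powr (2 * q - 1))"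
    using assms(2) by (intro sum.cong) (auto simp flip: * simp: power2_eq_square powr_add[symmetric])
  also have "\<dots> \<le> (\<Sum>i\<in>I. \<alpha> i * m powr (2 * q - 1))"
    using assms le by (intro sum_mono mult_left_mono powr_mono2) auto
  also have "\<dots> = (\<Sum>i\<in>I. \<alpha> i) * m powr (2 * q - 1)"
    by (simp add: sum_distrib_right)
  also have "\<dots> \<le> m * m powr (2 * q - 1)"
    using assms by (intro mult_right_mono) auto
  finally show ?thesis using *[OF m] by simp
qed

lemma sum_kern_bilinear_le:
  fixes \<alpha> \<beta> :: "nat \<Rightarrow> real"
  assumes "finite I" "\<And>i. i \<in> I \<Longrightarrow> \<alpha> i \<ge> 0" "\<And>i. i \<in> I \<Longrightarrow> \<beta> i \<ge> 0"
    "(\<Sum>i\<in>I. \<alpha> i) \<le> m" "(\<Sum>i\<in>I. \<beta> i) \<le> m" "q \<ge> 1 / 2" "0 \<le> z" "z < 1"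
  shows "(\<Sum>i\<in>I. \<Sum>j\<in>I. \<alpha> i powr q * \<beta> j powr q * kern z i j) \<le> (1 + 6 * (z / (1 - z))) * m powr (2 * q)"
  using assms
  by (intro schur_test sum_kern_le sum_powr_square_le) (auto simp: kern_nonneg kern_sym)

section \<open>A dominant index forced by a large bilinear form\<close>

lemma sum_sum_remove:
  fixes x :: "'a \<Rightarrow> 'a \<Rightarrow> real"
  assumes "finite I" "k \<in> I"
  shows "(\<Sum>i\<in>I. \<Sum>j\<in>I. x i j) = x k k + (\<Sum>j\<in>I - {k}. x k j) + (\<Sum>i\<in>I - {k}. x i k)
    + (\<Sum>i\<in>I - {k}. \<Sum>j\<in>I - {k}. x i j)"
  using assms by (simp add: sum.remove[OF assms] sum.distrib)

text \<open>The argument has two stages. Schur's test makes the off-diagonal part small, so the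
  diagonal carries nearly everything, which forces one product \<open>\<alpha> k * \<beta> k\<close>
  close to 1. The crude defect bound \<open>\<eta>\<close> is then improved: balancing the loss in
  the entry at \<open>k\<close> against the gain from all other entries yields a defect that is a
  power of \<open>z\<close>.\<close>

lemma concentration_aux:
  fixes \<alpha> \<beta> :: "nat \<Rightarrow> real"
  assumes I: "finite I" and \<alpha>: "\<And>i. i \<in> I \<Longrightarrow> \<alpha> i \<ge> 0" and \<beta>: "\<And>i. i \<in> I \<Longrightarrow> \<beta> i \<ge> 0"
    and sum\<alpha>: "(\<Sum>i\<in>I. \<alpha> i) = 1" and sum\<beta>: "(\<Sum>i\<in>I. \<beta> i) = 1"
    and q: "1 / 2 < q" "q < 1" and z: "0 < z" "z \<le> 1 / 2"
    and \<eta>: "0 < \<eta>" "\<eta> < 1" "7 * \<eta> powr (2 * q - 1) \<le> 1 / 4"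
    and z\<eta>: "(1 - \<eta>) powr (q - 1 / 2) \<le> 1 - 12 * z"
    and large: "1 \<le> (\<Sum>i\<in>I. \<Sum>j\<in>I. \<alpha> i powr q * \<beta> j powr q * kern z i j)"
  obtains k m where "k \<in> I" "m \<ge> 0" "m powr (1 - q) \<le> 96 * z"
    "(\<Sum>j\<in>I - {k}. \<alpha> k powr q * \<beta> j powr q * kern z k j) \<le> 12 * z * m powr q"
    "(\<Sum>i\<in>I - {k}. \<alpha> i powr q * \<beta> k powr q * kern z i k) \<le> 12 * z * m powr q"
    "(\<Sum>i\<in>I - {k}. \<Sum>j\<in>I - {k}. \<alpha> i powr q * \<beta> j powr q * kern z i j) \<le> 7 * m powr (2 * q)"
proof -
  let ?x = "\<lambda>i j. \<alpha> i powr q * \<beta> j powr q * kern z i j"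
  have z2: "6 * (z / (1 - z)) \<le> 12 * z"
    using z by (simp add: field_simps)
  have off: "(\<Sum>j\<in>I - {i}. kern z i j) \<le> 12 * z" for i
    using sum_kern_offdiag_le[OF I, of z i] z z2 by simp
  \<comment> \<open>Zeroing the diagonal leaves row sums of at most \<open>12 * z\<close>; Schur's
    test for this kernel shows how much the diagonal must supply.\<close>
  define off_kern where "off_kern = (\<lambda>i j. if i = j then 0 else kern z i j)"
  have off_row: "(\<Sum>j\<in>I. off_kern i j) \<le> 12 * z" for i
  proof -
    have "(\<Sum>j\<in>I. off_kern i j) = (\<Sum>j\<in>I - {i}. kern z i j)"
      using I by (intro sum.mono_neutral_cong_right) (auto simp: off_kern_def)
    thus ?thesis using off[of i] by simp
  qed
  have diag: "1 - 12 * z \<le> (\<Sum>i\<in>I. (\<alpha> i * \<beta> i) powr q)"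
  proof -
    have "(\<Sum>i\<in>I. \<Sum>j\<in>I. \<alpha> i powr q * \<beta> j powr q * off_kern i j) \<le> 12 * z * 1"
      using q z sum_powr_square_le[of I \<alpha> 1 q] sum_powr_square_le[of I \<beta> 1 q] I \<alpha> \<beta> sum\<alpha> sum\<beta>
      by (intro schur_test off_row) (auto simp: off_kern_def kern_nonneg kern_sym)
    moreover have "(\<Sum>i\<in>I. \<Sum>j\<in>I. ?x i j)
        = (\<Sum>i\<in>I. (\<alpha> i * \<beta> i) powr q + (\<Sum>j\<in>I. \<alpha> i powr q * \<beta> j powr q * off_kern i j))"
    proof (intro sum.cong refl)
      fix i assume i: "i \<in> I"
      have "(\<Sum>j\<in>I. ?x i j) = ?x i i + (\<Sum>j\<in>I - {i}. ?x i j)"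
        using i I by (simp add: sum.remove)
      also have "(\<Sum>j\<in>I - {i}. ?x i j) = (\<Sum>j\<in>I. \<alpha> i powr q * \<beta> j powr q * off_kern i j)"
        using I by (intro sum.mono_neutral_cong_left) (auto simp: off_kern_def)
      finally show "(\<Sum>j\<in>I. ?x i j)
          = (\<alpha> i * \<beta> i) powr q + (\<Sum>j\<in>I. \<alpha> i powr q * \<beta> j powr q * off_kern i j)"
        using \<alpha>[OF i] \<beta>[OF i] by (simp add: kern_def powr_mult)
    qed
    ultimately show ?thesis using large by (simp add: sum.distrib)
  qed
  have "I \<noteq> {}" using sum\<alpha> by auto
  hence "Max ((\<lambda>i. \<alpha> i * \<beta> i) ` I) \<in> (\<lambda>i. \<alpha> i * \<beta> i) ` I"
    using I by (intro Max_in) auto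
  then obtain k where k: "k \<in> I" and kMax: "\<alpha> k * \<beta> k = Max ((\<lambda>i. \<alpha> i * \<beta> i) ` I)"
    by (metis (no_types, lifting) imageE)
  have kmax: "\<alpha> i * \<beta> i \<le> \<alpha> k * \<beta> k" if "i \<in> I" for i
    unfolding kMax using I that by (intro Max_ge) auto
  have le1: "\<alpha> k \<le> 1" "\<beta> k \<le> 1"
    using member_le_sum[OF k, of \<alpha>] member_le_sum[OF k, of \<beta>] I \<alpha> \<beta> sum\<alpha> sum\<beta> by auto
  \<comment> \<open>Each term is split with exponents q - 1/2 and 1/2: the first factor is bounded
    by the largest product, the second by AM-GM, and the arithmetic means sum to 1.\<close>
  have "(\<Sum>i\<in>I. (\<alpha> i * \<beta> i) powr q) \<le> (\<Sum>i\<in>I. (\<alpha> k * \<beta> k) powr (q - 1 / 2) * ((\<alpha> i + \<beta> i) / 2))"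
  proof (intro sum_mono)
    fix i assume i: "i \<in> I"
    have "(\<alpha> i * \<beta> i) powr q = (\<alpha> i * \<beta> i) powr (q - 1 / 2) * (\<alpha> i * \<beta> i) powr (1 / 2)"
      by (simp flip: powr_add)
    also have "\<dots> \<le> (\<alpha> k * \<beta> k) powr (q - 1 / 2) * ((\<alpha> i + \<beta> i) / 2)"
    proof (rule mult_mono)
      show "(\<alpha> i * \<beta> i) powr (q - 1 / 2) \<le> (\<alpha> k * \<beta> k) powr (q - 1 / 2)"
        using kmax[OF i] \<alpha>[OF i] \<beta>[OF i] q by (intro powr_mono2) auto
      show "(\<alpha> i * \<beta> i) powr (1 / 2) \<le> (\<alpha> i + \<beta> i) / 2"
        using arith_geo_mean_sqrt[of "\<alpha> i" "\<beta> i"] \<alpha>[OF i] \<beta>[OF i] by (simp add: powr_half_sqrt)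
    qed auto
    finally show "(\<alpha> i * \<beta> i) powr q \<le> (\<alpha> k * \<beta> k) powr (q - 1 / 2) * ((\<alpha> i + \<beta> i) / 2)" .
  qed
  also have "\<dots> = (\<alpha> k * \<beta> k) powr (q - 1 / 2)"
    by (simp add: sum.distrib sum\<alpha> sum\<beta> flip: sum_distrib_left sum_divide_distrib)
  finally have "(1 - \<eta>) powr (q - 1 / 2) \<le> (\<alpha> k * \<beta> k) powr (q - 1 / 2)"
    using diag z\<eta> by linarith
  hence prod: "1 - \<eta> \<le> \<alpha> k * \<beta> k"
    using powr_less_mono2[of "q - 1 / 2" "\<alpha> k * \<beta> k" "1 - \<eta>"] q k \<alpha> \<beta> by fastforce
  \<comment> \<open>The mass missing at \<open>k\<close> on the worse of the two sides; it dominates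
    every other \<open>\<alpha> i\<close> and \<open>\<beta> i\<close>.\<close>
  define m where "m = max (1 - \<alpha> k) (1 - \<beta> k)"
  have m0: "m \<ge> 0" using le1 by (simp add: m_def)
  have m_eta: "m \<le> \<eta>"
  proof -
    have "\<alpha> k * \<beta> k \<le> \<alpha> k * 1" "\<alpha> k * \<beta> k \<le> 1 * \<beta> k"
      using le1 k \<alpha> \<beta> by (intro mult_mono; auto)+
    thus ?thesis using prod by (simp add: m_def)
  qed
  have rest: "(\<Sum>i\<in>I - {k}. \<alpha> i) \<le> m" "(\<Sum>i\<in>I - {k}. \<beta> i) \<le> m"
    using sum\<alpha> sum\<beta> by (auto simp: m_def sum.remove[OF I k])
  have mem: "\<alpha> i \<le> m" "\<beta> i \<le> m" if "i \<in> I - {k}" for i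
    using member_le_sum[OF that, of \<alpha>] member_le_sum[OF that, of \<beta>] I \<alpha> \<beta> rest by auto
  have p1: "x powr q \<le> 1" if "0 \<le> x" "x \<le> 1" for x
    using powr_mono2[of q x 1] q that by simp
  have row: "(\<Sum>j\<in>I - {k}. ?x k j) \<le> 12 * z * m powr q"
  proof -
    have "(\<Sum>j\<in>I - {k}. ?x k j) \<le> (\<Sum>j\<in>I - {k}. 1 * m powr q * kern z k j)"
      using mem \<alpha> \<beta> k le1 p1 q z
      by (intro sum_mono mult_right_mono mult_mono powr_mono2) (auto simp: kern_nonneg)
    also have "\<dots> \<le> m powr q * (12 * z)"
      unfolding sum_distrib_left[symmetric] mult_1_left by (intro mult_left_mono off) auto
    finally show ?thesis by (simp add: mult_ac)
  qed
  have col: "(\<Sum>i\<in>I - {k}. ?x i k) \<le> 12 * z * m powr q"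
  proof -
    have "(\<Sum>i\<in>I - {k}. ?x i k) \<le> (\<Sum>i\<in>I - {k}. m powr q * 1 * kern z k i)"
      unfolding kern_sym[of z _ k] using mem \<alpha> \<beta> k le1 p1 q z
      by (intro sum_mono mult_right_mono mult_mono powr_mono2) (auto simp: kern_nonneg)
    also have "\<dots> \<le> m powr q * (12 * z)"
      unfolding sum_distrib_left[symmetric] mult_1_right by (intro mult_left_mono off) auto
    finally show ?thesis by (simp add: mult_ac)
  qed
  have both: "(\<Sum>i\<in>I - {k}. \<Sum>j\<in>I - {k}. ?x i j) \<le> 7 * m powr (2 * q)"
  proof -
    have "(\<Sum>i\<in>I - {k}. \<Sum>j\<in>I - {k}. ?x i j) \<le> (1 + 6 * (z / (1 - z))) * m powr (2 * q)"
      using I \<alpha> \<beta> rest q z by (intro sum_kern_bilinear_le) auto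
    also have "\<dots> \<le> 7 * m powr (2 * q)"
      using z2 z by (intro mult_right_mono) auto
    finally show ?thesis .
  qed
  \<comment> \<open>One of the two factors is 1 - m and the other at most 1, and a power q > 1/2 of
    a number in [0, 1] is at most its square root. So the entry at \<open>k\<close> loses linearly
    in \<open>m\<close>.\<close>
  have "?x k k \<le> 1 - m / 2"
  proof -
    have "\<alpha> k * \<beta> k \<le> 1 - m"
      using mult_mono[of "\<alpha> k" "\<alpha> k" "\<beta> k" 1] mult_mono[of "\<alpha> k" 1 "\<beta> k" "\<beta> k"] le1 k \<alpha> \<beta>
      by (auto simp: m_def max_def)
    hence "?x k k \<le> (1 - m) powr q"
      using q k \<alpha> \<beta> by (auto simp: kern_def simp flip: powr_mult intro!: powr_mono2)
    also have "\<dots> \<le> (1 - m) powr (1 / 2)"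
      using q m0 m_eta \<eta> by (intro powr_mono') auto
    also have "\<dots> = sqrt (1 - m)"
      using m_eta \<eta> by (simp add: powr_half_sqrt)
    also have "\<dots> \<le> 1 - m / 2"
      using m_eta \<eta> m0 by (intro real_le_lsqrt) (auto simp: power2_eq_square algebra_simps)
    finally show ?thesis .
  qed
  \<comment> \<open>Loss and gain must balance. The last term is at most m/4 because 2 q > 1 and
    \<open>m \<le> \<eta>\<close>, so m/4 is left to be paid by the row and the column.\<close>
  hence "1 \<le> 1 - m / 2 + 24 * z * m powr q + 7 * m powr (2 * q)"
    using large row col both by (simp add: sum_sum_remove[OF I k])
  moreover have "7 * m powr (2 * q) \<le> m / 4"
  proof -
    have "7 * m powr (2 * q) = m * (7 * m powr (2 * q - 1))"
      using m0 powr_mult_base[of m "2 * q - 1"] by simp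
    also have "\<dots> \<le> m * (7 * \<eta> powr (2 * q - 1))"
      using m0 m_eta q by (intro mult_left_mono powr_mono2) auto
    also have "\<dots> \<le> m * (1 / 4)"
      using \<eta> m0 by (intro mult_left_mono) auto
    finally show ?thesis by simp
  qed
  ultimately have "m \<le> 96 * z * m powr q" by simp
  hence "m powr (1 - q) * m powr q \<le> 96 * z * m powr q"
    using m0 by (simp flip: powr_add)
  hence "m powr (1 - q) \<le> 96 * z"
    using m0 z by (cases "m = 0") auto
  thus ?thesis using that k m0 row col both by blast
qed

text \<open>Here \<open>\<alpha>\<close> and \<open>\<beta>\<close> are the shares of the two vertex
  masses over the valuations at \<open>p\<close>. The double sum is at least 1 when the mass bound
  holds without \<open>p\<close> but fails with it. The three sums in the conclusion control the
  edges for which only the second, only the first, or both valuations differ from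
  \<open>k\<close>.\<close>

definition concentrates :: "real \<Rightarrow> real \<Rightarrow> real \<Rightarrow> bool" where
  "concentrates q C p \<longleftrightarrow> (\<forall>I \<alpha> \<beta>.
     let x = (\<lambda>i j. \<alpha> i powr q * \<beta> j powr q * kern (p powr - (1 - q)) i j) in
       finite I \<longrightarrow> (\<forall>i\<in>I. \<alpha> i \<ge> 0) \<longrightarrow> (\<forall>i\<in>I. \<beta> i \<ge> 0) \<longrightarrow>
       (\<Sum>i\<in>I. \<alpha> i) = 1 \<longrightarrow> (\<Sum>i\<in>I. \<beta> i) = 1 \<longrightarrow> 1 \<le> (\<Sum>i\<in>I. \<Sum>j\<in>I. x i j) \<longrightarrow>
       (\<exists>k\<in>I. (\<Sum>j\<in>I - {k}. x k j) \<le> C / p \<and> (\<Sum>i\<in>I - {k}. x i k) \<le> C / p \<and>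
         (\<Sum>i\<in>I - {k}. \<Sum>j\<in>I - {k}. x i j) \<le> C * p powr - (2 * q)))"

lemma concentration:
  assumes q: "1 / 2 < q" "q < 1"
  obtains p1 C :: real where "p1 \<ge> 1" "C > 0" "\<And>p. p \<ge> p1 \<Longrightarrow> concentrates q C p"
proof -
  \<comment> \<open>This value solves \<open>7 * \<eta> powr (2 * q - 1) = 1 / 4\<close>.\<close>
  define \<eta> where "\<eta> = (1 / 28 :: real) powr (1 / (2 * q - 1))"
  have \<eta>: "0 < \<eta>" "\<eta> < 1" "7 * \<eta> powr (2 * q - 1) \<le> 1 / 4"
    using q powr_less_mono2[of "1 / (2 * q - 1)" "1 / 28" 1] by (auto simp: \<eta>_def powr_powr)
  \<comment> \<open>The two bounds are the smallness conditions on \<open>z\<close> in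
    \<open>concentration_aux\<close>; \<open>p1\<close> below ensures
    \<open>p powr - (1 - q) \<le> z0\<close>.\<close>
  define z0 where "z0 = min (1 / 2) ((1 - (1 - \<eta>) powr (q - 1 / 2)) / 12)"
  have "(1 - \<eta>) powr (q - 1 / 2) < 1" using q \<eta> powr_less_mono2[of "q - 1 / 2" "1 - \<eta>" 1] by simp
  hence z0: "z0 > 0" by (simp add: z0_def)
  \<comment> \<open>Raising \<open>m powr (1 - q) \<le> 96 * z\<close> to the power 1/(1 - q), with
    \<open>z = p powr - (1 - q)\<close>, gives \<open>m \<le> C0 / p\<close>.\<close>
  define C0 where "C0 = (96 :: real) powr (1 / (1 - q))"
  define C where "C = 12 * C0 powr q + 7 * C0 powr (2 * q)"
  define p1 where "p1 = max 1 (z0 powr - (1 / (1 - q)))"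
  show ?thesis
  proof (rule that)
    show "p1 \<ge> 1" by (simp add: p1_def)
    show "C > 0" by (simp add: C_def C0_def add_pos_pos)
    fix p :: real assume p: "p \<ge> p1"
    show "concentrates q C p"
      unfolding concentrates_def Let_def
    proof (intro allI impI)
      fix I :: "nat set" and \<alpha> \<beta> :: "nat \<Rightarrow> real"
      assume I: "finite I" and \<alpha>: "\<forall>i\<in>I. \<alpha> i \<ge> 0" and \<beta>: "\<forall>i\<in>I. \<beta> i \<ge> 0"
        and s: "(\<Sum>i\<in>I. \<alpha> i) = 1" "(\<Sum>i\<in>I. \<beta> i) = 1"
        and large: "1 \<le> (\<Sum>i\<in>I. \<Sum>j\<in>I. \<alpha> i powr q * \<beta> j powr q * kern (p powr - (1 - q)) i j)"
      define z where "z = p powr - (1 - q)"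
      have pge1: "p \<ge> 1" using p by (simp add: p1_def)
      have zpos: "z > 0" using pge1 by (simp add: z_def)
      have zz0: "z \<le> z0"
      proof -
        have "z0 powr - (1 / (1 - q)) \<le> p" using p by (simp add: p1_def)
        hence "p powr - (1 - q) \<le> (z0 powr - (1 / (1 - q))) powr - (1 - q)"
          using q z0 by (intro powr_mono2') auto
        moreover have "(- (1 / (1 - q))) * (- (1 - q)) = 1" using q(2) by (simp del: minus_diff_eq)
        ultimately show ?thesis using z0 by (simp only: z_def powr_powr powr_one)
      qed
      obtain k m where k: "k \<in> I" and m: "m \<ge> 0" "m powr (1 - q) \<le> 96 * z"
        and row: "(\<Sum>j\<in>I - {k}. \<alpha> k powr q * \<beta> j powr q * kern z k j) \<le> 12 * z * m powr q"
        and col: "(\<Sum>i\<in>I - {k}. \<alpha> i powr q * \<beta> k powr q * kern z i k) \<le> 12 * z * m powr q"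
        and both: "(\<Sum>i\<in>I - {k}. \<Sum>j\<in>I - {k}. \<alpha> i powr q * \<beta> j powr q * kern z i j) \<le> 7 * m powr (2 * q)"
        by (rule concentration_aux[where q = q and z = z and \<eta> = \<eta>, OF I bspec[OF \<alpha>] bspec[OF \<beta>] s])
          (use q zpos zz0 \<eta> large in \<open>auto simp: z0_def z_def\<close>)
      have mC0: "m \<le> C0 / p"
      proof -
        have "(m powr (1 - q)) powr (1 / (1 - q)) \<le> (96 * z) powr (1 / (1 - q))"
          using m q by (intro powr_mono2) auto
        moreover have "(1 - q) * (1 / (1 - q)) = 1" "- (1 - q) * (1 / (1 - q)) = - 1"
          using q(2) by (simp_all del: minus_diff_eq)
        ultimately have "m \<le> C0 * p powr - 1"
          using m(1) zpos by (simp only: powr_powr C0_def z_def powr_mult powr_one)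
        thus ?thesis using pge1 by (simp add: powr_minus_divide)
      qed
      have C0: "C0 > 0" by (simp add: C0_def)
      have zm: "12 * z * m powr q \<le> C / p"
      proof -
        have "12 * z * m powr q \<le> 12 * z * (C0 / p) powr q"
          using m mC0 q zpos by (intro mult_left_mono powr_mono2) auto
        also have "\<dots> = 12 * C0 powr q * (p powr - (1 - q) * p powr - q)"
          using pge1 C0 by (simp add: powr_divide z_def powr_minus field_simps)
        \<comment> \<open>The decay 1 - q of the kernel and the power q of the defect add up to 1,
          so single deviations cost order 1/p.\<close>
        also have "p powr - (1 - q) * p powr - q = 1 / p"
          using pge1 by (simp only: powr_add[symmetric]) (simp add: powr_neg_one)
        also have "12 * C0 powr q * (1 / p) \<le> C * (1 / p)"
          using pge1 by (intro mult_right_mono) (auto simp: C_def)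
        finally show ?thesis by simp
      qed
      have mm: "7 * m powr (2 * q) \<le> C * p powr - (2 * q)"
      proof -
        have "7 * m powr (2 * q) \<le> 7 * (C0 / p) powr (2 * q)"
          using m mC0 q by (intro mult_left_mono powr_mono2) auto
        also have "\<dots> = 7 * C0 powr (2 * q) * p powr - (2 * q)"
          using pge1 C0 by (simp add: powr_divide powr_minus field_simps)
        also have "\<dots> \<le> C * p powr - (2 * q)"
          by (intro mult_right_mono) (auto simp: C_def)
        finally show ?thesis .
      qed
      show "\<exists>k\<in>I. (\<Sum>j\<in>I - {k}. \<alpha> k powr q * \<beta> j powr q * kern (p powr - (1 - q)) k j) \<le> C / p \<and>
          (\<Sum>i\<in>I - {k}. \<alpha> i powr q * \<beta> k powr q * kern (p powr - (1 - q)) i k) \<le> C / p \<and>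
          (\<Sum>i\<in>I - {k}. \<Sum>j\<in>I - {k}. \<alpha> i powr q * \<beta> j powr q * kern (p powr - (1 - q)) i j)
            \<le> C * p powr - (2 * q)"
        using k order_trans[OF row zm] order_trans[OF col zm] order_trans[OF both mm]
        unfolding z_def by (intro bexI[of _ k] conjI)
    qed
  qed
qed

section \<open>Edges near a fixed integer\<close>

text \<open>All \<open>v\<close> in the fiber have the same least common multiple with
  \<open>N\<close>, namely N a. So the denominators coincide, the \<open>v\<close> are divisors of N
  a, and the hypothesis on the Dirichlet convolution at N a gives the bound. For
  \<open>a = 0\<close> the fiber is empty.\<close>

lemma sum_fiber_le:
  fixes f :: "nat \<Rightarrow> real"
  assumes "nonneg_fun f" "\<forall>n\<ge>1. one_conv f n \<le> real n" "finite X" "\<And>v. v \<in> X \<Longrightarrow> v > 0" "N > 0"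
  shows "(\<Sum>v | v \<in> X \<and> v div gcd v N = a. f v / (real v * real (N div gcd v N))) \<le> 1"
proof (cases "a = 0")
  case False
  let ?F = "{v \<in> X. v div gcd v N = a}"
  \<comment> \<open>so every \<open>v\<close> in the fiber divides \<open>N a\<close>\<close>
  have eq: "v * (N div gcd v N) = N * a" if "v \<in> ?F" for v
  proof -
    have "v * (N div gcd v N) = (v div gcd v N) * gcd v N * (N div gcd v N)" by simp
    also have "\<dots> = (v div gcd v N) * (N div gcd v N * gcd v N)" by (simp only: mult_ac)
    finally show ?thesis using that by (simp add: mult.commute)
  qed
  have "(\<Sum>v\<in>?F. f v / (real v * real (N div gcd v N))) = (\<Sum>v\<in>?F. f v) / real (N * a)"
    unfolding sum_divide_distrib of_nat_mult[symmetric] using eq by (intro sum.cong) auto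
  also have "\<dots> \<le> 1"
  proof -
    have "(\<Sum>v\<in>?F. f v) \<le> one_conv f (N * a)"
      unfolding one_conv_def
    proof (rule sum_mono2)
      show "finite {d. d dvd N * a}" using False assms by simp
      show "?F \<subseteq> {d. d dvd N * a}" using eq by (auto intro: dvdI[OF sym])
      fix d assume "d \<in> {d. d dvd N * a} - ?F"
      hence "d > 0" using False assms by (auto intro!: Nat.gr0I)
      thus "f d \<ge> 0" using assms by (auto simp: nonneg_fun_def)
    qed
    also have "\<dots> \<le> real (N * a)"
      using assms(2,5) False by (metis less_one linorder_not_less mult_is_0 neq0_conv)
    finally show ?thesis using False assms by (simp add: divide_le_eq_1)
  qed
  finally show ?thesis .
next
  case True
  have "v div gcd v N \<noteq> 0" if "v \<in> X" for v
    using assms(4)[OF that] by (simp add: div_eq_0_iff dvd_imp_le leD)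
  hence empty: "{v. v \<in> X \<and> v div gcd v N = a} = {}" using True by auto
  show ?thesis unfolding empty by simp
qed

text \<open>Each possible numerator 1, ..., \<open>A\<close> contributes at most 1. This linear
  count cancels the maximal numerators in the path count below.\<close>

lemma sum_fibers_le:
  fixes f :: "nat \<Rightarrow> real"
  assumes "nonneg_fun f" "\<forall>n\<ge>1. one_conv f n \<le> real n" "finite X" "\<And>v. v \<in> X \<Longrightarrow> v > 0" "N > 0"
    "\<And>v. v \<in> X \<Longrightarrow> v div gcd v N \<le> A"
  shows "(\<Sum>v\<in>X. f v / (real v * real (N div gcd v N))) \<le> real A"
proof -
  have pos: "v div gcd v N \<ge> 1" if "v \<in> X" for v
    using assms(4)[OF that] by (simp add: Suc_le_eq div_greater_zero_iff)
  have "(\<Sum>v\<in>X. f v / (real v * real (N div gcd v N)))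
      = (\<Sum>a\<in>{1..A}. \<Sum>v | v \<in> X \<and> v div gcd v N = a. f v / (real v * real (N div gcd v N)))"
    using assms pos by (intro sum.group[symmetric]) auto
  also have "\<dots> \<le> (\<Sum>a\<in>{1..A}. 1)"
    by (intro sum_mono sum_fiber_le assms)
  finally show ?thesis by simp
qed

section \<open>A subgraph of large minimum degree and its paths of length two\<close>

text \<open>Vertices of too small degree are deleted one at a time. Deleting \<open>v\<close>
  removes edge mass at most \<open>x * \<mu> v\<close>, exactly the drop of the left-hand side of
  the inequality, so the strict inequality persists. It cannot hold when a vertex set is empty, so
  the process ends at a nonempty subgraph.\<close>

lemma min_degree_subgraph:
  fixes \<mu> \<nu> :: "nat \<Rightarrow> real" and G :: "nat \<Rightarrow> nat \<Rightarrow> bool"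
  assumes "finite V" "finite W" "\<And>v. v \<in> V \<Longrightarrow> \<mu> v \<ge> 0" "\<And>w. w \<in> W \<Longrightarrow> \<nu> w \<ge> 0" "x \<ge> 0" "y \<ge> 0"
    "x * (\<Sum>v\<in>V. \<mu> v) + y * (\<Sum>w\<in>W. \<nu> w) < (\<Sum>v\<in>V. \<Sum>w | w \<in> W \<and> G v w. \<mu> v * \<nu> w)"
  shows "\<exists>V' W'. V' \<subseteq> V \<and> W' \<subseteq> W \<and> V' \<noteq> {} \<and> W' \<noteq> {} \<and>
    (\<forall>v\<in>V'. x \<le> (\<Sum>w | w \<in> W' \<and> G v w. \<nu> w)) \<and>
    (\<forall>w\<in>W'. y \<le> (\<Sum>v | v \<in> V' \<and> G v w. \<mu> v))"
  using assms
proof (induction "card V + card W" arbitrary: V W rule: less_induct)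
  case less
  let ?T = "\<lambda>V W. (\<Sum>v\<in>V. \<Sum>w | w \<in> W \<and> G v w. \<mu> v * \<nu> w)"
  let ?Q = "\<lambda>V' W'. V' \<noteq> {} \<and> W' \<noteq> {} \<and>
    (\<forall>v\<in>V'. x \<le> (\<Sum>w | w \<in> W' \<and> G v w. \<nu> w)) \<and>
    (\<forall>w\<in>W'. y \<le> (\<Sum>v | v \<in> V' \<and> G v w. \<mu> v))"
  let ?\<Phi> = "\<lambda>V W. x * (\<Sum>v\<in>V. \<mu> v) + y * (\<Sum>w\<in>W. \<nu> w) < ?T V W"
  have swap: "?T V W = (\<Sum>w\<in>W. \<Sum>v | v \<in> V \<and> G v w. \<mu> v * \<nu> w)" if "finite V" "finite W" for V W
    using sum.swap_restrict[OF that, of "\<lambda>v w. \<mu> v * \<nu> w" G] by simp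
  consider (v) v where "v \<in> V" "(\<Sum>w | w \<in> W \<and> G v w. \<nu> w) < x"
    | (w) w where "w \<in> W" "(\<Sum>v | v \<in> V \<and> G v w. \<mu> v) < y"
    | (good) "\<And>v. v \<in> V \<Longrightarrow> x \<le> (\<Sum>w | w \<in> W \<and> G v w. \<nu> w)"
      "\<And>w. w \<in> W \<Longrightarrow> y \<le> (\<Sum>v | v \<in> V \<and> G v w. \<mu> v)"
    by (meson linorder_not_less)
  thus ?case
  proof cases
    case v
    have "?T V W = \<mu> v * (\<Sum>w | w \<in> W \<and> G v w. \<nu> w) + ?T (V - {v}) W"
      using v less.prems by (simp add: sum.remove sum_distrib_left)
    also have "\<dots> \<le> \<mu> v * x + ?T (V - {v}) W"
      using v less.prems by (intro add_right_mono mult_left_mono) auto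
    finally have "?\<Phi> (V - {v}) W"
      using less.prems(7) v less.prems by (simp add: sum.remove algebra_simps)
    moreover have "card (V - {v}) < card V"
      using v less.prems by (meson card_Diff1_less)
    ultimately have "\<exists>V' W'. V' \<subseteq> V - {v} \<and> W' \<subseteq> W \<and> ?Q V' W'"
      by (intro less.hyps less.prems(1-6) finite_Diff) (simp_all add: less.prems)
    thus ?thesis by (meson Diff_subset subset_trans)
  next
    case w
    have "?T V W = (\<Sum>w\<in>W. \<Sum>v | v \<in> V \<and> G v w. \<mu> v * \<nu> w)"
      using less.prems by (intro swap)
    also have "\<dots> = (\<Sum>v | v \<in> V \<and> G v w. \<mu> v * \<nu> w)
        + (\<Sum>w\<in>W - {w}. \<Sum>v | v \<in> V \<and> G v w. \<mu> v * \<nu> w)"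
      using w less.prems by (intro sum.remove)
    also have "(\<Sum>w\<in>W - {w}. \<Sum>v | v \<in> V \<and> G v w. \<mu> v * \<nu> w) = ?T V (W - {w})"
      using less.prems by (intro swap[symmetric]) auto
    also have "(\<Sum>v | v \<in> V \<and> G v w. \<mu> v * \<nu> w) = \<nu> w * (\<Sum>v | v \<in> V \<and> G v w. \<mu> v)"
      by (simp add: sum_distrib_left mult_ac)
    finally have "?T V W = \<nu> w * (\<Sum>v | v \<in> V \<and> G v w. \<mu> v) + ?T V (W - {w})" .
    also have "\<dots> \<le> \<nu> w * y + ?T V (W - {w})"
      using w less.prems by (intro add_right_mono mult_left_mono) auto
    finally have "?\<Phi> V (W - {w})"
      using less.prems(7) w less.prems by (simp add: sum.remove algebra_simps)
    moreover have "card (W - {w}) < card W"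
      using w less.prems by (meson card_Diff1_less)
    ultimately have "\<exists>V' W'. V' \<subseteq> V \<and> W' \<subseteq> W - {w} \<and> ?Q V' W'"
      by (intro less.hyps less.prems(1-6) finite_Diff) (simp_all add: less.prems)
    thus ?thesis by (meson Diff_subset subset_trans)
  next
    case good
    have "0 \<le> x * (\<Sum>v\<in>V. \<mu> v) + y * (\<Sum>w\<in>W. \<nu> w)"
      using less.prems by (intro add_nonneg_nonneg mult_nonneg_nonneg sum_nonneg) auto
    hence "?T V W > 0" using less.prems(7) by linarith
    hence "V \<noteq> {}" "W \<noteq> {}" by auto
    thus ?thesis using good by blast
  qed
qed

text \<open>Writing \<open>v = N a / b\<close> and \<open>w = N c / d\<close> in lowest terms, the edge hypotheses say \<open>b c \<psi>(v) \<le> 1\<close>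
  and \<open>d a \<theta>(w) \<le> 1\<close>. Choosing \<open>w\<^sub>0\<close> with \<open>c\<close> maximal bounds \<open>\<psi>\<close> on the neighbours of \<open>w\<^sub>0\<close> without
  a logarithmic loss.\<close>

lemma edge_measure_square_le:
  fixes f g \<psi> \<theta> :: "nat \<Rightarrow> real"
  assumes f: "nonneg_fun f" "\<forall>n\<ge>1. one_conv f n \<le> real n"
    and g: "nonneg_fun g" "\<forall>n\<ge>1. one_conv g n \<le> real n"
    and \<psi>: "nonneg_fun \<psi>" and \<theta>: "nonneg_fun \<theta>"
    and V: "finite V" "\<And>v. v \<in> V \<Longrightarrow> v > 0" and W: "finite W" "\<And>w. w \<in> W \<Longrightarrow> w > 0"
    and E: "E \<subseteq> V \<times> W" and N: "N > 0"
    and edge1: "\<And>v w. (v, w) \<in> E \<Longrightarrow> real (N div gcd v N) * real (w div gcd w N) * \<psi> v \<le> 1"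
    and edge2: "\<And>v w. (v, w) \<in> E \<Longrightarrow> real (N div gcd w N) * real (v div gcd v N) * \<theta> w \<le> 1"
  shows "(\<Sum>(v, w)\<in>E. mu_pt f \<psi> v * mu_pt g \<theta> w)\<^sup>2 \<le> 16 * (\<Sum>v\<in>V. mu_pt f \<psi> v) * (\<Sum>w\<in>W. mu_pt g \<theta> w)"
proof -
  let ?\<mu> = "mu_pt f \<psi>" and ?\<nu> = "mu_pt g \<theta>"
  have \<mu>: "?\<mu> v \<ge> 0" if "v \<in> V" for v
    using V(2)[OF that] f \<psi> by (simp add: mu_pt_def nonneg_fun_def)
  have \<nu>: "?\<nu> w \<ge> 0" if "w \<in> W" for w
    using W(2)[OF that] g \<theta> by (simp add: mu_pt_def nonneg_fun_def)
  define T where "T = (\<Sum>(v, w)\<in>E. ?\<mu> v * ?\<nu> w)"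
  define mV where "mV = (\<Sum>v\<in>V. ?\<mu> v)"
  define mW where "mW = (\<Sum>w\<in>W. ?\<nu> w)"
  have m0: "mV \<ge> 0" "mW \<ge> 0" unfolding mV_def mW_def using \<mu> \<nu> by (auto intro: sum_nonneg)
  have "T \<le> (\<Sum>(v, w)\<in>V \<times> W. ?\<mu> v * ?\<nu> w)"
    unfolding T_def using E V W \<mu> \<nu> by (intro sum_mono2) auto
  also have "\<dots> = mV * mW"
    by (simp add: mV_def mW_def sum_product sum.cartesian_product)
  finally have TM: "T \<le> mV * mW" .
  have T0: "T \<ge> 0" unfolding T_def using E \<mu> \<nu> by (auto intro!: sum_nonneg)
  have "T\<^sup>2 \<le> 16 * mV * mW"
  proof (cases "T = 0")
    case True
    thus ?thesis using m0 by simp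
  next
    case False
    hence T: "T > 0" using T0 by simp
    hence m: "mV > 0" "mW > 0" using TM m0 by (auto simp: less_le)
    \<comment> \<open>With these thresholds \<open>x * mV + y * mW\<close> is half of
      \<open>T\<close>, and \<open>x * y \<le> 1\<close> is equivalent to the claim.\<close>
    define x where "x = T / (4 * mV)"
    define y where "y = T / (4 * mW)"
    have T_eq: "T = (\<Sum>v\<in>V. \<Sum>w | w \<in> W \<and> (v, w) \<in> E. ?\<mu> v * ?\<nu> w)"
    proof -
      have "E = Sigma V (\<lambda>v. {w \<in> W. (v, w) \<in> E})" using E by auto
      thus ?thesis unfolding T_def using V W by (subst sum.Sigma) auto
    qed
    have "x * mV + y * mW < T" using T m by (simp add: x_def y_def)
    hence "x * (\<Sum>v\<in>V. ?\<mu> v) + y * (\<Sum>w\<in>W. ?\<nu> w) < (\<Sum>v\<in>V. \<Sum>w | w \<in> W \<and> (v, w) \<in> E. ?\<mu> v * ?\<nu> w)"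
      unfolding T_eq[symmetric] mV_def mW_def .
    moreover have "x \<ge> 0" "y \<ge> 0" using T m by (auto simp: x_def y_def)
    ultimately have "\<exists>V' W'. V' \<subseteq> V \<and> W' \<subseteq> W \<and> V' \<noteq> {} \<and> W' \<noteq> {} \<and>
        (\<forall>v\<in>V'. x \<le> (\<Sum>w | w \<in> W' \<and> (v, w) \<in> E. ?\<nu> w)) \<and>
        (\<forall>w\<in>W'. y \<le> (\<Sum>v | v \<in> V' \<and> (v, w) \<in> E. ?\<mu> v))"
      using V(1) W(1) \<mu> \<nu> by (intro min_degree_subgraph)
    then obtain V' W' where V': "V' \<subseteq> V" "V' \<noteq> {}" and W': "W' \<subseteq> W" "W' \<noteq> {}"
      and degV: "\<forall>v\<in>V'. x \<le> (\<Sum>w | w \<in> W' \<and> (v, w) \<in> E. ?\<nu> w)"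
      and degW: "\<forall>w\<in>W'. y \<le> (\<Sum>v | v \<in> V' \<and> (v, w) \<in> E. ?\<mu> v)"
      by (elim exE conjE) (rule that)
    \<comment> \<open>On the second side, \<open>a w\<close> and \<open>b w\<close> are the
      numerator c and the denominator d of w / N.\<close>
    define a where "a = (\<lambda>v. v div gcd v N)"
    define b where "b = (\<lambda>v. N div gcd v N)"
    have fin: "finite V'" "finite W'" using V' W' V W by (auto intro: finite_subset)
    have apos: "a v > 0" if "v > 0" for v using that by (simp add: a_def div_greater_zero_iff)
    have bpos: "b v > 0" for v using N by (simp add: b_def div_greater_zero_iff dvd_imp_le)
    have "Max (a ` W') \<in> a ` W'" using fin W' by (intro Max_in) auto
    then obtain w0 where w0: "w0 \<in> W'" and "a w0 = Max (a ` W')"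
      by (metis imageE)
    hence w0max: "a w \<le> a w0" if "w \<in> W'" for w
      using fin that by simp
    have a0: "a w0 > 0" using apos[of w0] W(2)[of w0] w0 W' by auto
    \<comment> \<open>The largest numerator among the neighbours of \<open>w\<close> gives the
      strongest bound on \<open>\<theta> w\<close>. The maximum is unspecified if \<open>w\<close>
      has no neighbour in \<open>V'\<close>, but then the sum over its neighbours is empty.\<close>
    define A where "A = (\<lambda>w. Max (a ` {v \<in> V'. (v, w) \<in> E}))"
    \<comment> \<open>The mass of the pairs (v, w) for which w0, v, w is a path. The degree bounds
      give \<open>x * y \<le> P\<close>, the edge hypotheses \<open>P \<le> 1\<close>.\<close>
    define P where "P = (\<Sum>v | v \<in> V' \<and> (v, w0) \<in> E. ?\<mu> v * (\<Sum>w | w \<in> W' \<and> (v, w) \<in> E. ?\<nu> w))"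
    have "x * y \<le> x * (\<Sum>v | v \<in> V' \<and> (v, w0) \<in> E. ?\<mu> v)"
      using degW w0 T m by (intro mult_left_mono) (auto simp: x_def)
    also have "\<dots> \<le> P"
      unfolding P_def mult.commute[of x] sum_distrib_right using degV V' \<mu>
      by (intro sum_mono mult_left_mono) auto
    also have "P \<le> (\<Sum>v | v \<in> V' \<and> (v, w0) \<in> E. f v / (real v * real (b v)) / real (a w0) *
        (\<Sum>w | w \<in> W' \<and> (v, w) \<in> E. g w / (real w * real (b w)) / real (A w)))"
      unfolding P_def
    proof (rule sum_mono)
      fix v assume v: "v \<in> {v \<in> V'. (v, w0) \<in> E}"
      have vpos: "v > 0" using v V' V by auto
      have fv: "f v \<ge> 0" using f vpos by (simp add: nonneg_fun_def)
      have "\<psi> v \<le> 1 / (real (b v) * real (a w0))"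
        using edge1[of v w0] v a0 bpos[of v] by (simp add: field_simps a_def b_def)
      hence "f v / real v * \<psi> v \<le> f v / real v * (1 / (real (b v) * real (a w0)))"
        using fv by (intro mult_left_mono) auto
      hence \<mu>_le: "?\<mu> v \<le> f v / (real v * real (b v)) / real (a w0)"
        by (simp add: mu_pt_def)
      have \<nu>_le: "?\<nu> w \<le> g w / (real w * real (b w)) / real (A w)" if w: "w \<in> {w \<in> W'. (v, w) \<in> E}" for w
      proof -
        have wpos: "w > 0" using w W' W by auto
        have gw: "g w \<ge> 0" using g wpos by (simp add: nonneg_fun_def)
        have "A w \<in> a ` {v \<in> V'. (v, w) \<in> E}"
          unfolding A_def using v w fin by (intro Max_in) auto
        then obtain v' where v': "v' \<in> V'" "(v', w) \<in> E" "A w = a v'" by auto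
        have "A w > 0" using apos[of v'] V(2)[of v'] v' V' by auto
        hence "\<theta> w \<le> 1 / (real (b w) * real (A w))"
          using edge2[of v' w] v' bpos[of w] by (simp add: field_simps a_def b_def)
        hence "g w / real w * \<theta> w \<le> g w / real w * (1 / (real (b w) * real (A w)))"
          using gw by (intro mult_left_mono) auto
        thus ?thesis by (simp add: mu_pt_def)
      qed
      show "?\<mu> v * (\<Sum>w | w \<in> W' \<and> (v, w) \<in> E. ?\<nu> w) \<le> f v / (real v * real (b v)) / real (a w0) *
          (\<Sum>w | w \<in> W' \<and> (v, w) \<in> E. g w / (real w * real (b w)) / real (A w))"
      proof (rule mult_mono[OF \<mu>_le sum_mono[OF \<nu>_le]])
        show "f v / (real v * real (b v)) / real (a w0) \<ge> 0" using fv by simp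
        show "(\<Sum>w | w \<in> W' \<and> (v, w) \<in> E. ?\<nu> w) \<ge> 0" using W' \<nu> by (intro sum_nonneg) auto
      qed
    qed
    also have "\<dots> \<le> (\<Sum>v\<in>V'. f v / (real v * real (b v)) / real (a w0) *
        (\<Sum>w | w \<in> W' \<and> (v, w) \<in> E. g w / (real w * real (b w)) / real (A w)))"
      using fin V' W' V W f g
      by (intro sum_mono2) (auto simp: nonneg_fun_def subset_iff intro!: mult_nonneg_nonneg divide_nonneg_nonneg sum_nonneg)
    also have "\<dots> = (\<Sum>v\<in>V'. \<Sum>w | w \<in> W' \<and> (v, w) \<in> E.
        f v / (real v * real (b v)) / real (a w0) * (g w / (real w * real (b w)) / real (A w)))"
      by (simp only: sum_distrib_left)
    also have "\<dots> = (\<Sum>w\<in>W'. \<Sum>v | v \<in> V' \<and> (v, w) \<in> E.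
        f v / (real v * real (b v)) / real (a w0) * (g w / (real w * real (b w)) / real (A w)))"
      using fin by (intro sum.swap_restrict)
    also have "\<dots> = (\<Sum>w\<in>W'. g w / (real w * real (b w)) / real (a w0) *
        ((\<Sum>v | v \<in> V' \<and> (v, w) \<in> E. f v / (real v * real (b v))) / real (A w)))"
      by (simp add: sum_distrib_left sum_divide_distrib mult_ac)
    \<comment> \<open>All neighbours of \<open>w\<close> have numerator at most \<open>A w\<close>,
      so the inner count cancels \<open>A w\<close>; by the choice of \<open>w0\<close> the outer
      count then cancels \<open>a w0\<close>.\<close>
    also have "\<dots> \<le> (\<Sum>w\<in>W'. g w / (real w * real (b w)) / real (a w0) * 1)"
    proof (intro sum_mono mult_left_mono)
      fix w assume w: "w \<in> W'"
      have "(\<Sum>v | v \<in> V' \<and> (v, w) \<in> E. f v / (real v * real (b v))) \<le> real (A w)"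
        unfolding b_def using f fin V' V N
        by (intro sum_fibers_le) (auto simp: A_def a_def)
      thus "(\<Sum>v | v \<in> V' \<and> (v, w) \<in> E. f v / (real v * real (b v))) / real (A w) \<le> 1"
        by (auto simp: divide_le_eq_1)
      show "g w / (real w * real (b w)) / real (a w0) \<ge> 0"
        using w W' W g by (auto simp: nonneg_fun_def subset_iff)
    qed
    also have "\<dots> = (\<Sum>w\<in>W'. g w / (real w * real (b w))) / real (a w0)"
      by (simp add: sum_divide_distrib)
    also have "\<dots> \<le> 1"
    proof -
      have "(\<Sum>w\<in>W'. g w / (real w * real (b w))) \<le> real (a w0)"
        unfolding b_def using g fin W' W N w0max
        by (intro sum_fibers_le) (auto simp: a_def)
      thus ?thesis using a0 by simp
    qed
    finally have "x * y \<le> 1" .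
    thus ?thesis using m by (simp add: x_def y_def field_simps power2_eq_square)
  qed
  thus ?thesis by (simp add: T_def mV_def mW_def)
qed

section \<open>Removing a prime\<close>

text \<open>For positive \<open>v\<close> and \<open>w\<close> these are the primes p >= t dividing
  v w / gcd(v, w)^2. The form with valuations is the one that behaves well when a prime is
  removed.\<close>

definition dev_primes :: "real \<Rightarrow> nat \<Rightarrow> nat \<Rightarrow> nat set" where
  "dev_primes t v w = {p. prime p \<and> real p \<ge> t \<and> multiplicity p v \<noteq> multiplicity p w}"

text \<open>The exponential tilt of Chernoff's argument. The factor \<open>q\<close> in the exponent
  matches the power \<open>q\<close> in the mass bound, so that the saving becomes the q-th power of
  exp(- C t).\<close>

definition weight :: "real \<Rightarrow> real \<Rightarrow> nat \<Rightarrow> nat \<Rightarrow> real" where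
  "weight q t v w = exp (q * t * (\<Sum>p\<in>dev_primes t v w. 1 / real p))"

definition wmass ::
  "real \<Rightarrow> real \<Rightarrow> (nat \<Rightarrow> real) \<Rightarrow> (nat \<Rightarrow> real) \<Rightarrow> (nat \<Rightarrow> real) \<Rightarrow> (nat \<Rightarrow> real) \<Rightarrow> (nat \<times> nat) set \<Rightarrow> real" where
  "wmass q t f g \<psi> \<theta> E = (\<Sum>(v, w)\<in>E. mu_pt f \<psi> v * mu_pt g \<theta> w * weight q t v w)"

text \<open>Finite vertex sets take the place of the supports, and the edge conditions are cleared
  of denominators. This class is stable under stripping a prime from the vertices and rescaling
  \<open>\<psi>\<close> and \<open>\<theta>\<close>.\<close>

definition admissible ::
  "nat set \<Rightarrow> (nat \<Rightarrow> real) \<Rightarrow> (nat \<Rightarrow> real) \<Rightarrow> nat set \<Rightarrow> nat set \<Rightarrow> (nat \<times> nat) set \<Rightarrow> bool" where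
  "admissible P \<psi> \<theta> V W E \<longleftrightarrow>
     finite V \<and> finite W \<and> (\<forall>v\<in>V \<union> W. v > 0 \<and> prime_factors v \<subseteq> P) \<and>
     nonneg_fun \<psi> \<and> nonneg_fun \<theta> \<and> E \<subseteq> V \<times> W \<and>
     (\<forall>(v, w)\<in>E. real w * \<psi> v \<le> real (gcd v w) \<and> real v * \<theta> w \<le> real (gcd v w))"

text \<open>The graph and \<open>\<psi>\<close>, \<open>\<theta>\<close> are quantified while
  \<open>f\<close> and \<open>g\<close> stay fixed, because removing a prime changes the former
  only.\<close>

definition mass_bound ::
  "real \<Rightarrow> real \<Rightarrow> (nat \<Rightarrow> real) \<Rightarrow> (nat \<Rightarrow> real) \<Rightarrow> nat set \<Rightarrow> real \<Rightarrow> bool" where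
  "mass_bound q t f g P K \<longleftrightarrow>
     (\<forall>\<psi> \<theta> V W E. admissible P \<psi> \<theta> V W E \<longrightarrow>
        wmass q t f g \<psi> \<theta> E \<le> K * ((\<Sum>v\<in>V. mu_pt f \<psi> v) * (\<Sum>w\<in>W. mu_pt g \<theta> w)) powr q)"

lemma finite_dev_primes: "v > 0 \<Longrightarrow> w > 0 \<Longrightarrow> finite (dev_primes t v w)"
proof -
  assume "v > 0" "w > 0"
  hence "dev_primes t v w \<subseteq> prime_factors v \<union> prime_factors w"
    by (auto simp: dev_primes_def prime_factors_multiplicity)
  thus ?thesis by (rule finite_subset) simp
qed

lemma mu_pt_nonneg: "nonneg_fun f \<Longrightarrow> nonneg_fun \<psi> \<Longrightarrow> v > 0 \<Longrightarrow> mu_pt f \<psi> v \<ge> 0"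
  by (simp add: mu_pt_def nonneg_fun_def)

lemma weight_pos: "weight q t v w > 0"
  by (simp add: weight_def)

lemma le_self_of_one_conv_le:
  assumes "nonneg_fun f" "\<forall>n\<ge>1. one_conv f n \<le> real n" "n > 0"
  shows "f n \<le> real n"
proof -
  have "f n \<le> one_conv f n"
    unfolding one_conv_def using assms
    by (intro member_le_sum) (auto simp: nonneg_fun_def intro!: Nat.gr0I)
  also have "\<dots> \<le> real n" using assms by auto
  finally show ?thesis .
qed

section \<open>Effect of prime powers on gcd, valuations and weight\<close>

lemma gcd_prime_power_mult:
  fixes p v w :: nat
  assumes "prime p" "\<not> p dvd v" "\<not> p dvd w"
  shows "gcd (p ^ i * v) (p ^ j * w) = p ^ min i j * gcd v w"
proof -
  have cop: "coprime (p ^ n) v" "coprime (p ^ n) w" for n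
    using assms by (auto simp: prime_imp_coprime)
  show ?thesis
  proof (cases "i \<le> j")
    case True
    have "gcd (p ^ i * v) (p ^ j * w) = gcd (p ^ i * v) (p ^ i * (p ^ (j - i) * w))"
      using True by (simp flip: power_add mult.assoc)
    also have "\<dots> = p ^ i * gcd v (p ^ (j - i) * w)"
      by (simp add: gcd_mult_distrib_nat)
    also have "gcd v (p ^ (j - i) * w) = gcd v w"
      using cop(1)[of "j - i"] by (intro gcd_mult_right_left_cancel) (simp add: coprime_commute)
    finally show ?thesis using True by (simp add: min_def)
  next
    case False
    have "gcd (p ^ i * v) (p ^ j * w) = gcd (p ^ j * (p ^ (i - j) * v)) (p ^ j * w)"
      using False by (simp flip: power_add mult.assoc)
    also have "\<dots> = p ^ j * gcd (p ^ (i - j) * v) w"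
      by (simp add: gcd_mult_distrib_nat)
    also have "gcd (p ^ (i - j) * v) w = gcd v w"
      using cop(2)[of "i - j"] by (intro gcd_mult_left_left_cancel) (simp add: coprime_commute)
    finally show ?thesis using False by (simp add: min_def)
  qed
qed

lemma multiplicity_prime_power_mult_other:
  fixes p s v :: nat
  assumes "prime p" "prime s" "s \<noteq> p" "v > 0"
  shows "multiplicity s (p ^ i * v) = multiplicity s v"
  using assms by (subst prime_elem_multiplicity_mult_distrib)
    (auto simp: prime_multiplicity_other prime_elem_multiplicity_power_distrib not_dvd_imp_multiplicity_0 primes_dvd_imp_eq)

lemma multiplicity_prime_power_mult_same:
  fixes p v :: nat
  assumes "prime p" "\<not> p dvd v" "v > 0"
  shows "multiplicity p (p ^ i * v) = i"
  using assms by (subst prime_elem_multiplicity_mult_distrib)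
    (auto simp: not_dvd_imp_multiplicity_0)

text \<open>Multiplication can only add \<open>p\<close> to the deviating primes, and only when the
  exponents differ and p >= t. The extra factor exp(q t / p) is then at most e.\<close>

lemma weight_prime_power_mult_le:
  fixes p v w :: nat
  assumes p: "prime p" and v: "\<not> p dvd v" "v > 0" and w: "\<not> p dvd w" "w > 0"
    and q: "0 \<le> q" "q \<le> 1" and t: "t \<ge> 0"
  shows "weight q t (p ^ i * v) (p ^ j * w) \<le> weight q t v w * (if i = j then 1 else 3)"
proof -
  let ?S = "if i \<noteq> j \<and> real p \<ge> t then {p} else {}"
  have dev: "s \<in> dev_primes t (p ^ i * v) (p ^ j * w) \<longleftrightarrow> s \<in> dev_primes t v w \<union> ?S" for s
  proof (cases "s = p")
    case True
    thus ?thesis using p v w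
      by (auto simp: dev_primes_def multiplicity_prime_power_mult_same not_dvd_imp_multiplicity_0)
  next
    case False
    thus ?thesis using p v w
      by (cases "prime s") (auto simp: dev_primes_def multiplicity_prime_power_mult_other)
  qed
  hence dev: "dev_primes t (p ^ i * v) (p ^ j * w) = dev_primes t v w \<union> ?S" by blast
  have disj: "dev_primes t v w \<inter> ?S = {}"
    using v w by (auto simp: dev_primes_def not_dvd_imp_multiplicity_0)
  have "weight q t (p ^ i * v) (p ^ j * w) = weight q t v w * exp (q * t * (\<Sum>p\<in>?S. 1 / real p))"
    unfolding weight_def dev
    using v w disj by (subst sum.union_disjoint) (auto simp: finite_dev_primes distrib_left exp_add)
  also have "exp (q * t * (\<Sum>p\<in>?S. 1 / real p)) \<le> (if i = j then 1 else 3)"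
  proof (cases "i \<noteq> j \<and> real p \<ge> t")
    case True
    have "q * (t / real p) \<le> 1 * 1"
      using True q t prime_gt_0_nat[OF p] by (intro mult_mono) (auto simp: divide_le_eq_1)
    hence "exp (q * t / real p) \<le> exp 1" by simp
    also have "\<dots> \<le> 3" by (rule exp_le)
    finally show ?thesis using True by simp
  qed auto
  finally show ?thesis by (simp add: weight_pos)
qed

section \<open>Edges with one given pair of valuations\<close>

text \<open>Stripping the powers of \<open>p\<close> gives an admissible graph on the remaining
  primes, to which the assumed bound applies. The original measures are constant multiples of the
  rescaled ones, and the two constants have product at most p^(-|i - j|). The q-th power of this
  product restores the original masses; the remaining power 1 - q is the decay of the
  kernel.\<close>

lemma mass_bound_fiber:
  fixes f g \<psi> \<theta> :: "nat \<Rightarrow> real" and p :: nat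
  assumes f: "nonneg_fun f" "multiplicative_fun f" "\<forall>n\<ge>1. one_conv f n \<le> real n"
    and g: "nonneg_fun g" "multiplicative_fun g" "\<forall>n\<ge>1. one_conv g n \<le> real n"
    and p: "prime p" and q: "0 \<le> q" "q \<le> 1" and t: "t \<ge> 0" and K: "K \<ge> 0"
    and bound: "mass_bound q t f g (P - {p}) K" and adm: "admissible P \<psi> \<theta> V W E"
  shows "wmass q t f g \<psi> \<theta> {(v, w) \<in> E. multiplicity p v = i \<and> multiplicity p w = j}
    \<le> K * ((\<Sum>v | v \<in> V \<and> multiplicity p v = i. mu_pt f \<psi> v) *
            (\<Sum>w | w \<in> W \<and> multiplicity p w = j. mu_pt g \<theta> w)) powr q * kern (p powr - (1 - q)) i j"
proof -
  note adm = adm[unfolded admissible_def]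
  have p0: "p > 0" using p by (rule prime_gt_0_nat)
  define strip where "strip = (\<lambda>k X. {v. \<not> p dvd v \<and> p ^ k * v \<in> X})"
  define V' where "V' = strip i V"
  define W' where "W' = strip j W"
  define E' where "E' = {(v, w). v \<in> V' \<and> w \<in> W' \<and> (p ^ i * v, p ^ j * w) \<in> E}"
  \<comment> \<open>the rescaling that turns the edge condition on \<open>(p\<^sup>i v, p\<^sup>j w)\<close> into the one on \<open>(v, w)\<close>; the
      exponents are truncated differences\<close>
  define \<psi>' where "\<psi>' = (\<lambda>v. real p ^ (j - i) * \<psi> (p ^ i * v))"
  define \<theta>' where "\<theta>' = (\<lambda>w. real p ^ (i - j) * \<theta> (p ^ j * w))"
  have strip_pos: "v > 0" if "v \<in> strip k X" for k v and X :: "nat set"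
    using that by (auto simp: strip_def intro!: Nat.gr0I)
  have bij: "bij_betw (\<lambda>v. p ^ k * v) (strip k X) {v \<in> X. multiplicity p v = k}"
    if "\<forall>v\<in>X. v > 0" for k X
  proof (rule bij_betw_imageI)
    show "inj_on (\<lambda>v. p ^ k * v) (strip k X)" using p0 by (auto simp: inj_on_def)
    show "(\<lambda>v. p ^ k * v) ` strip k X = {v \<in> X. multiplicity p v = k}"
    proof (intro equalityI subsetI)
      fix v assume "v \<in> {v \<in> X. multiplicity p v = k}"
      hence v: "v \<in> X" "multiplicity p v = k" "v \<noteq> 0" using that by auto
      obtain v' where "v = p ^ multiplicity p v * v'" "\<not> p dvd v'"
        by (rule multiplicity_decompose'[OF v(3), of p]) (use p not_prime_unit in auto)
      thus "v \<in> (\<lambda>v. p ^ k * v) ` strip k X" using v by (auto simp: strip_def)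
    next
      fix v assume "v \<in> (\<lambda>v. p ^ k * v) ` strip k X"
      thus "v \<in> {v \<in> X. multiplicity p v = k}"
        using p strip_pos by (auto simp: strip_def multiplicity_prime_power_mult_same)
    qed
  qed
  have posVW: "\<forall>v\<in>V. v > 0" "\<forall>w\<in>W. w > 0" using adm by auto
  have fin_strip: "finite (strip k X)" if "finite X" "\<forall>v\<in>X. v > 0" for k X
    using bij_betw_finite[OF bij[OF that(2), of k]] that by auto
  have \<mu>: "mu_pt f \<psi> (p ^ i * v) = f (p ^ i) / real p ^ (i + (j - i)) * mu_pt f \<psi>' v" if "v \<in> V'" for v
  proof -
    have "f (p ^ i * v) = f (p ^ i) * f v"
      using f(2) strip_pos[of v i V] that p p0 
      by (auto simp: multiplicative_fun_def V'_def strip_def prime_imp_coprime)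
    thus ?thesis using p0 by (simp add: mu_pt_def \<psi>'_def power_add)
  qed
  have \<nu>: "mu_pt g \<theta> (p ^ j * w) = g (p ^ j) / real p ^ (j + (i - j)) * mu_pt g \<theta>' w" if "w \<in> W'" for w
  proof -
    have "g (p ^ j * w) = g (p ^ j) * g w"
      using g(2) strip_pos[of w j W] that p p0
      by (auto simp: multiplicative_fun_def W'_def strip_def prime_imp_coprime)
    thus ?thesis using p0 by (simp add: mu_pt_def \<theta>'_def power_add)
  qed
  \<comment> \<open>Both exponents \<open>i + (j - i)\<close> and \<open>j + (i - j)\<close> equal
    max(i, j). As f(p^i) <= p^i and g(p^j) <= p^j, the product is at most p to the power i + j - 2
    max(i, j) = -|i - j|.\<close>
  define A where "A = f (p ^ i) / real p ^ (i + (j - i)) * (g (p ^ j) / real p ^ (j + (i - j)))"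
  have fg0: "f (p ^ i) \<ge> 0" "g (p ^ j) \<ge> 0" using f g p0 by (auto simp: nonneg_fun_def)
  have A0: "A \<ge> 0" using fg0 by (simp add: A_def)
  have A_le: "A \<le> 1 / real p ^ ((i - j) + (j - i))"
  proof -
    have "f (p ^ i) \<le> real p ^ i" "g (p ^ j) \<le> real p ^ j"
      using le_self_of_one_conv_le[OF f(1,3), of "p ^ i"] le_self_of_one_conv_le[OF g(1,3), of "p ^ j"] p0 by auto
    hence "f (p ^ i) / real p ^ i * (g (p ^ j) / real p ^ j) \<le> 1 * 1"
      using p0 fg0 by (intro mult_mono) auto
    hence "f (p ^ i) / real p ^ i * (g (p ^ j) / real p ^ j) / real p ^ ((i - j) + (j - i))
        \<le> 1 / real p ^ ((i - j) + (j - i))"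
      using p0 by (intro divide_right_mono) auto
    thus ?thesis by (simp add: A_def power_add mult_ac)
  qed
  let ?mV = "\<Sum>v | v \<in> V \<and> multiplicity p v = i. mu_pt f \<psi> v"
  let ?mW = "\<Sum>w | w \<in> W \<and> multiplicity p w = j. mu_pt g \<theta> w"
  let ?mV' = "\<Sum>v\<in>V'. mu_pt f \<psi>' v" and ?mW' = "\<Sum>w\<in>W'. mu_pt g \<theta>' w"
  have nn': "nonneg_fun \<psi>'" "nonneg_fun \<theta>'"
    using adm p0 by (auto simp: nonneg_fun_def \<psi>'_def \<theta>'_def)
  have "?mV = (\<Sum>v\<in>V'. mu_pt f \<psi> (p ^ i * v))"
    unfolding V'_def by (rule sum.reindex_bij_betw[OF bij[OF posVW(1)], symmetric])
  hence mV: "?mV = f (p ^ i) / real p ^ (i + (j - i)) * ?mV'"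
    using \<mu> by (simp add: sum_distrib_left)
  have "?mW = (\<Sum>w\<in>W'. mu_pt g \<theta> (p ^ j * w))"
    unfolding W'_def by (rule sum.reindex_bij_betw[OF bij[OF posVW(2)], symmetric])
  hence mW: "?mW = g (p ^ j) / real p ^ (j + (i - j)) * ?mW'"
    using \<nu> by (simp add: sum_distrib_left)
  have m0: "?mV' \<ge> 0" "?mW' \<ge> 0"
    using mu_pt_nonneg[OF f(1) nn'(1)] mu_pt_nonneg[OF g(1) nn'(2)] strip_pos
    by (auto simp: V'_def W'_def intro!: sum_nonneg)
  have adm': "admissible (P - {p}) \<psi>' \<theta>' V' W' E'"
    unfolding admissible_def
  proof (intro conjI ballI)
    show "finite V'" "finite W'" using adm fin_strip posVW by (auto simp: V'_def W'_def)
    show "nonneg_fun \<psi>'" "nonneg_fun \<theta>'" by (fact nn')+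
    show "E' \<subseteq> V' \<times> W'" by (auto simp: E'_def)
    fix v assume v: "v \<in> V' \<union> W'"
    show "v > 0" using v strip_pos by (auto simp: V'_def W'_def)
    obtain k where k: "p ^ k * v \<in> V \<union> W" "\<not> p dvd v"
      using v by (auto simp: V'_def W'_def strip_def)
    hence "prime_factors (p ^ k * v) \<subseteq> P" "p ^ k * v > 0" using adm p0 by auto
    moreover have "prime_factors v \<subseteq> prime_factors (p ^ k * v)"
      using \<open>p ^ k * v > 0\<close> by (intro dvd_prime_factors) auto
    ultimately show "prime_factors v \<subseteq> P - {p}" using k by auto
  next
    fix e assume "e \<in> E'"
    then obtain v w where e: "e = (v, w)" "v \<in> V'" "w \<in> W'" "(p ^ i * v, p ^ j * w) \<in> E"
      by (auto simp: E'_def)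
    have gcd: "real (gcd (p ^ i * v) (p ^ j * w)) = real p ^ min i j * real (gcd v w)"
      using gcd_prime_power_mult[OF p, of v w i j] e by (auto simp: V'_def W'_def strip_def)
    have 1: "real p ^ j * real w * \<psi> (p ^ i * v) \<le> real p ^ min i j * real (gcd v w)"
      "real p ^ i * real v * \<theta> (p ^ j * w) \<le> real p ^ min i j * real (gcd v w)"
      using adm e gcd by fastforce+
    \<comment> \<open>The truncated exponents satisfy \<open>min i j + (j - i) = j\<close> and
      \<open>min i j + (i - j) = i\<close>, so cancelling \<open>p ^ min i j\<close> leaves the edge
      conditions of the stripped pair.\<close>
    have "real p ^ min i j * (real w * \<psi>' v) = real p ^ j * real w * \<psi> (p ^ i * v)"
      "real p ^ min i j * (real v * \<theta>' w) = real p ^ i * real v * \<theta> (p ^ j * w)"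
      by (auto simp: \<psi>'_def \<theta>'_def min_def simp flip: power_add)
    with 1 have "real p ^ min i j * (real w * \<psi>' v) \<le> real p ^ min i j * real (gcd v w)"
      "real p ^ min i j * (real v * \<theta>' w) \<le> real p ^ min i j * real (gcd v w)"
      by (simp_all only:)
    thus "case e of (v, w) \<Rightarrow> real w * \<psi>' v \<le> real (gcd v w) \<and> real v * \<theta>' w \<le> real (gcd v w)"
      using p0 e by simp
  qed
  let ?h = "if i = j then 1 else 3 :: real"
  have bijE: "bij_betw (\<lambda>(v, w). (p ^ i * v, p ^ j * w)) E' {(v, w) \<in> E. multiplicity p v = i \<and> multiplicity p w = j}"
  proof (rule bij_betw_imageI)
    show "inj_on (\<lambda>(v, w). (p ^ i * v, p ^ j * w)) E'" using p0 by (auto simp: inj_on_def)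
    have 1: "(\<lambda>v. p ^ i * v) ` V' = {v \<in> V. multiplicity p v = i}"
      "(\<lambda>w. p ^ j * w) ` W' = {w \<in> W. multiplicity p w = j}"
      unfolding V'_def W'_def
      by (rule bij_betw_imp_surj_on[OF bij[OF posVW(1)]], rule bij_betw_imp_surj_on[OF bij[OF posVW(2)]])
    show "(\<lambda>(v, w). (p ^ i * v, p ^ j * w)) ` E' = {(v, w) \<in> E. multiplicity p v = i \<and> multiplicity p w = j}"
    proof (intro equalityI subsetI)
      fix e assume "e \<in> (\<lambda>(v, w). (p ^ i * v, p ^ j * w)) ` E'"
      thus "e \<in> {(v, w) \<in> E. multiplicity p v = i \<and> multiplicity p w = j}"
        using 1 by (auto simp: E'_def)
    next
      fix e assume "e \<in> {(v, w) \<in> E. multiplicity p v = i \<and> multiplicity p w = j}"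
      then obtain v w where e: "e = (v, w)" "(v, w) \<in> E" "multiplicity p v = i" "multiplicity p w = j" by auto
      hence "v \<in> (\<lambda>v. p ^ i * v) ` V'" "w \<in> (\<lambda>w. p ^ j * w) ` W'" unfolding 1 using adm by auto
      then obtain v' w' where "v' \<in> V'" "w' \<in> W'" "v = p ^ i * v'" "w = p ^ j * w'" by auto
      thus "e \<in> (\<lambda>(v, w). (p ^ i * v, p ^ j * w)) ` E'" using e by (auto simp: E'_def)
    qed
  qed
  have "wmass q t f g \<psi> \<theta> {(v, w) \<in> E. multiplicity p v = i \<and> multiplicity p w = j}
      = (\<Sum>(v, w)\<in>E'. mu_pt f \<psi> (p ^ i * v) * mu_pt g \<theta> (p ^ j * w) * weight q t (p ^ i * v) (p ^ j * w))"
    unfolding wmass_def sum.reindex_bij_betw[OF bijE, symmetric] by (simp add: case_prod_unfold)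
  also have "\<dots> \<le> (\<Sum>(v, w)\<in>E'. A * ?h * (mu_pt f \<psi>' v * mu_pt g \<theta>' w * weight q t v w))"
  proof (intro sum_mono, clarify)
    fix v w assume e: "(v, w) \<in> E'"
    hence vw: "v \<in> V'" "w \<in> W'" by (auto simp: E'_def)
    have pos: "v > 0" "w > 0" "\<not> p dvd v" "\<not> p dvd w"
      using vw strip_pos by (auto simp: V'_def W'_def strip_def)
    have "mu_pt f \<psi> (p ^ i * v) * mu_pt g \<theta> (p ^ j * w) * weight q t (p ^ i * v) (p ^ j * w)
      = A * (mu_pt f \<psi>' v * mu_pt g \<theta>' w) * weight q t (p ^ i * v) (p ^ j * w)"
      using \<mu>[OF vw(1)] \<nu>[OF vw(2)] by (simp add: A_def)
    also have "\<dots> \<le> A * (mu_pt f \<psi>' v * mu_pt g \<theta>' w) * (weight q t v w * ?h)"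
      using pos q t p A0 mu_pt_nonneg[OF f(1) nn'(1)] mu_pt_nonneg[OF g(1) nn'(2)]
      by (intro mult_left_mono weight_prime_power_mult_le) auto
    finally show "mu_pt f \<psi> (p ^ i * v) * mu_pt g \<theta> (p ^ j * w) * weight q t (p ^ i * v) (p ^ j * w)
      \<le> A * ?h * (mu_pt f \<psi>' v * mu_pt g \<theta>' w * weight q t v w)"
      by (simp only: mult_ac)
  qed
  also have "\<dots> = A * ?h * wmass q t f g \<psi>' \<theta>' E'"
    unfolding wmass_def by (simp only: sum_distrib_left case_prod_unfold)
  also have "\<dots> \<le> A * ?h * (K * (?mV' * ?mW') powr q)"
    using bound adm' A0 unfolding mass_bound_def by (intro mult_left_mono) auto
  also have "\<dots> = K * (A * (?mV' * ?mW')) powr q * (A powr (1 - q) * ?h)"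
  proof -
    have "A = A powr q * A powr (1 - q)"
      using A0 by (cases "A = 0") (auto simp flip: powr_add)
    hence "A * ?h * (K * (?mV' * ?mW') powr q) = A powr q * A powr (1 - q) * ?h * (K * (?mV' * ?mW') powr q)"
      by simp
    thus ?thesis using A0 m0 by (simp only: powr_mult mult_nonneg_nonneg mult_ac)
  qed
  also have "A * (?mV' * ?mW') = ?mV * ?mW"
    unfolding mV mW A_def by (simp only: mult_ac)
  also have "K * (?mV * ?mW) powr q * (A powr (1 - q) * ?h) \<le> K * (?mV * ?mW) powr q * kern (real p powr - (1 - q)) i j"
  proof (intro mult_left_mono)
    have "A powr (1 - q) \<le> (1 / real p ^ ((i - j) + (j - i))) powr (1 - q)"
      using A0 A_le q by (intro powr_mono2) auto
    also have "\<dots> = (real p powr - (1 - q)) ^ ((i - j) + (j - i))"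
    proof -
      have "1 / real p ^ ((i - j) + (j - i)) = real p powr - real ((i - j) + (j - i))"
        using p0 by (simp only: powr_minus_divide powr_realpow of_nat_0_less_iff)
      moreover have "(real p powr - (1 - q)) ^ ((i - j) + (j - i))
          = (real p powr - (1 - q)) powr real ((i - j) + (j - i))"
        using p0 by (intro powr_realpow[symmetric]) simp
      moreover have "- real ((i - j) + (j - i)) * (1 - q) = - (1 - q) * real ((i - j) + (j - i))"
        by (simp only: mult_minus_left mult.commute)
      ultimately show ?thesis by (simp only: powr_powr)
    qed
    finally show "A powr (1 - q) * ?h \<le> kern (real p powr - (1 - q)) i j"
      by (auto simp: kern_def)
  qed (use K in auto)
  finally show ?thesis .
qed

section \<open>Recombination over all valuations at one prime\<close>

lemma wmass_fibers:
  assumes "finite E" "finite I" "finite J"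
  shows "wmass q t f g \<psi> \<theta> {(v, w) \<in> E. multiplicity p v \<in> I \<and> multiplicity p w \<in> J}
    = (\<Sum>i\<in>I. \<Sum>j\<in>J. wmass q t f g \<psi> \<theta> {(v, w) \<in> E. multiplicity p v = i \<and> multiplicity p w = j})"
proof -
  let ?E = "{(v, w) \<in> E. multiplicity p v \<in> I \<and> multiplicity p w \<in> J}"
  let ?m = "\<lambda>(v, w). (multiplicity p v, multiplicity p w)"
  have "wmass q t f g \<psi> \<theta> ?E = (\<Sum>y\<in>I \<times> J. wmass q t f g \<psi> \<theta> {e \<in> ?E. ?m e = y})"
    unfolding wmass_def using assms
    by (intro sum.group[symmetric]) (auto intro: finite_subset[OF _ assms(1)])
  also have "\<dots> = (\<Sum>(i, j)\<in>I \<times> J. wmass q t f g \<psi> \<theta> {(v, w) \<in> E. multiplicity p v = i \<and> multiplicity p w = j})"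
    by (intro sum.cong refl) (auto intro!: arg_cong[where f = "wmass q t f g \<psi> \<theta>"])
  finally show ?thesis by (simp add: sum.cartesian_product)
qed

lemma wmass_term_nonneg:
  assumes "nonneg_fun f" "nonneg_fun g" "admissible P \<psi> \<theta> V W E" "(v, w) \<in> E"
  shows "mu_pt f \<psi> v * mu_pt g \<theta> w * weight q t v w \<ge> 0"
  using assms by (intro mult_nonneg_nonneg mu_pt_nonneg less_imp_le[OF weight_pos]) (auto simp: admissible_def)

lemma sum_vertex_fibers:
  fixes \<mu> :: "nat \<Rightarrow> real"
  assumes "finite V" "finite I" "\<And>v. v \<in> V \<Longrightarrow> h v \<in> I"
  shows "(\<Sum>i\<in>I. \<Sum>v | v \<in> V \<and> h v = i. \<mu> v) = (\<Sum>v\<in>V. \<mu> v)"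
  using assms by (intro sum.group) auto

text \<open>The fiber bounds add up to the kernel form, which Schur's test controls for every prime:
  p >= 2 and q <= 9/10 keep \<open>z\<close> away from 1, so the loss is an absolute
  constant.\<close>

lemma mass_bound_add_prime:
  assumes f: "nonneg_fun f" "multiplicative_fun f" "\<forall>n\<ge>1. one_conv f n \<le> real n"
    and g: "nonneg_fun g" "multiplicative_fun g" "\<forall>n\<ge>1. one_conv g n \<le> real n"
    and p: "prime p" and q: "1 / 2 \<le> q" "q \<le> 9 / 10" and t: "t \<ge> 0" and K: "K \<ge> 0"
    and bound: "mass_bound q t f g (P - {p}) K"
  shows "mass_bound q t f g P (1000 * K)"
  unfolding mass_bound_def
proof (intro allI impI)
  fix \<psi> \<theta> V W E assume adm: "admissible P \<psi> \<theta> V W E"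
  note adm' = adm[unfolded admissible_def]
  define I where "I = multiplicity p ` (V \<union> W)"
  define a where "a = (\<lambda>i. \<Sum>v | v \<in> V \<and> multiplicity p v = i. mu_pt f \<psi> v)"
  define b where "b = (\<lambda>j. \<Sum>w | w \<in> W \<and> multiplicity p w = j. mu_pt g \<theta> w)"
  define mV where "mV = (\<Sum>v\<in>V. mu_pt f \<psi> v)"
  define mW where "mW = (\<Sum>w\<in>W. mu_pt g \<theta> w)"
  define z where "z = real p powr - (1 - q)"
  have finI: "finite I" using adm' by (simp add: I_def)
  have finE: "finite E" using adm' by (auto intro: finite_subset)
  have ab: "a i \<ge> 0" "b i \<ge> 0" for i
    using adm' f g by (auto simp: a_def b_def intro!: sum_nonneg mu_pt_nonneg)
  have sums: "(\<Sum>i\<in>I. a i) = mV" "(\<Sum>j\<in>I. b j) = mW"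
    unfolding a_def b_def mV_def mW_def using adm' finI by (auto intro!: sum_vertex_fibers simp: I_def)
  have m0: "mV \<ge> 0" "mW \<ge> 0" using ab by (auto simp flip: sums intro!: sum_nonneg)
  have z: "0 < z" "z \<le> 99 / 100"
  proof -
    show "z > 0" using prime_gt_0_nat[OF p] by (simp add: z_def)
    have "z \<le> real p powr - (1 / 10)"
      using q prime_ge_1_nat[OF p] unfolding z_def by (intro powr_mono) auto
    also have "\<dots> \<le> 2 powr - (1 / 10)"
      using prime_ge_2_nat[OF p] by (intro powr_mono2') auto
    also have "\<dots> = (1 / 2) powr (1 / 10)" by (simp add: powr_minus_divide powr_divide)
    \<comment> \<open>The tenth power of 99/100 still exceeds 1/2.\<close>
    also have "\<dots> \<le> ((99 / 100) powr 10) powr (1 / 10)"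
      by (intro powr_mono2) (auto simp: power_divide)
    also have "\<dots> = (99 / 100 :: real)"
      by (subst powr_powr) simp
    finally show "z \<le> 99 / 100" .
  qed
  have main: "(\<Sum>i\<in>I. \<Sum>j\<in>I. a i powr q * b j powr q * kern z i j) \<le> 1000 * (mV * mW) powr q"
  proof (cases "mV = 0 \<or> mW = 0")
    case True
    hence "(\<forall>i\<in>I. a i = 0) \<or> (\<forall>i\<in>I. b i = 0)"
      using sums finI ab by (metis sum_nonneg_eq_0_iff)
    thus ?thesis by (auto intro!: sum_nonpos)
  next
    case False
    hence m: "mV > 0" "mW > 0" using m0 by auto
    \<comment> \<open>Both distributions are normalised to total mass 1, since the kernel estimate
      uses one common bound for the two sums.\<close>
    have "(\<Sum>i\<in>I. \<Sum>j\<in>I. a i powr q * b j powr q * kern z i j)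
      = mV powr q * mW powr q * (\<Sum>i\<in>I. \<Sum>j\<in>I. (a i / mV) powr q * (b j / mW) powr q * kern z i j)"
      unfolding sum_distrib_left using ab m by (intro sum.cong refl) (simp add: powr_divide)
    also have "\<dots> \<le> mV powr q * mW powr q * ((1 + 6 * (z / (1 - z))) * 1 powr (2 * q))"
      using ab m finI q z sums
      by (intro mult_left_mono sum_kern_bilinear_le) (auto simp flip: sum_divide_distrib)
    also have "\<dots> \<le> mV powr q * mW powr q * 1000"
    proof (intro mult_left_mono)
      \<comment> \<open>The kernel factor is therefore at most 1 + 6 * 99 = 595.\<close>
      have "z / (1 - z) \<le> 99" using z by (simp add: field_simps)
      thus "(1 + 6 * (z / (1 - z))) * 1 powr (2 * q) \<le> 1000" by simp
    qed auto
    finally show ?thesis using m by (simp add: powr_mult)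
  qed
  have S_fib: "wmass q t f g \<psi> \<theta> E
      = (\<Sum>i\<in>I. \<Sum>j\<in>I. wmass q t f g \<psi> \<theta> {(v, w) \<in> E. multiplicity p v = i \<and> multiplicity p w = j})"
  proof -
    have "{(v, w) \<in> E. multiplicity p v \<in> I \<and> multiplicity p w \<in> I} = E"
      using adm' by (auto simp: I_def)
    thus ?thesis using wmass_fibers[OF finE finI finI, of q t f g \<psi> \<theta> p] by simp
  qed
  also have "\<dots> \<le> (\<Sum>i\<in>I. \<Sum>j\<in>I. K * (a i * b j) powr q * kern z i j)"
    unfolding a_def b_def z_def using q t K
    by (intro sum_mono mass_bound_fiber[OF f g p _ _ _ _ bound adm]) auto
  also have "\<dots> = K * (\<Sum>i\<in>I. \<Sum>j\<in>I. a i powr q * b j powr q * kern z i j)"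
    using ab by (simp add: sum_distrib_left powr_mult mult.assoc)
  also have "\<dots> \<le> K * (1000 * (mV * mW) powr q)"
    by (rule mult_left_mono[OF main K])
  finally show "wmass q t f g \<psi> \<theta> E
      \<le> 1000 * K * ((\<Sum>v\<in>V. mu_pt f \<psi> v) * (\<Sum>w\<in>W. mu_pt g \<theta> w)) powr q"
    by (simp add: mV_def mW_def mult_ac)
qed

text \<open>If the total exceeds the bound while the bound holds for the remaining primes, the share
  of each fiber in the total is at most the corresponding entry of the kernel form in the normalised
  masses. The shares add up to 1, so that form is at least 1 and concentration at \<open>p\<close>
  applies.\<close>

lemma exceptional_mass:
  assumes f: "nonneg_fun f" "multiplicative_fun f" "\<forall>n\<ge>1. one_conv f n \<le> real n"
    and g: "nonneg_fun g" "multiplicative_fun g" "\<forall>n\<ge>1. one_conv g n \<le> real n"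
    and p: "prime p" and q: "1 / 2 < q" "q < 1" and t: "t \<ge> 0" and K: "K \<ge> 0"
    and conc: "concentrates q C (real p)" and C: "C > 0"
    and bound: "mass_bound q t f g (P - {p}) K" and adm: "admissible P \<psi> \<theta> V W E"
    and large: "K * ((\<Sum>v\<in>V. mu_pt f \<psi> v) * (\<Sum>w\<in>W. mu_pt g \<theta> w)) powr q < wmass q t f g \<psi> \<theta> E"
  obtains k where
    "wmass q t f g \<psi> \<theta> {(v, w) \<in> E. multiplicity p v \<noteq> k \<or> multiplicity p w \<noteq> k}
      \<le> 3 * C / real p * wmass q t f g \<psi> \<theta> E"
    "wmass q t f g \<psi> \<theta> {(v, w) \<in> E. multiplicity p v \<noteq> k \<and> multiplicity p w \<noteq> k}
      \<le> C * real p powr - (2 * q) * wmass q t f g \<psi> \<theta> E"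
proof -
  note adm' = adm[unfolded admissible_def]
  define I where "I = multiplicity p ` (V \<union> W)"
  define a where "a = (\<lambda>i. \<Sum>v | v \<in> V \<and> multiplicity p v = i. mu_pt f \<psi> v)"
  define b where "b = (\<lambda>j. \<Sum>w | w \<in> W \<and> multiplicity p w = j. mu_pt g \<theta> w)"
  define mV where "mV = (\<Sum>v\<in>V. mu_pt f \<psi> v)"
  define mW where "mW = (\<Sum>w\<in>W. mu_pt g \<theta> w)"
  define z where "z = real p powr - (1 - q)"
  define S where "S = wmass q t f g \<psi> \<theta> E"
  define Sf where "Sf = (\<lambda>i j. wmass q t f g \<psi> \<theta> {(v, w) \<in> E. multiplicity p v = i \<and> multiplicity p w = j})"
  have finI: "finite I" using adm' by (simp add: I_def)
  have finE: "finite E" using adm' by (auto intro: finite_subset)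
  have ab: "a i \<ge> 0" "b i \<ge> 0" for i
    using adm' f g by (auto simp: a_def b_def intro!: sum_nonneg mu_pt_nonneg)
  have sums: "(\<Sum>i\<in>I. a i) = mV" "(\<Sum>j\<in>I. b j) = mW"
    unfolding a_def b_def mV_def mW_def using adm' finI by (auto intro!: sum_vertex_fibers simp: I_def)
  have m0: "mV \<ge> 0" "mW \<ge> 0" using ab by (auto simp flip: sums intro!: sum_nonneg)
  have large': "K * (mV * mW) powr q < S" using large by (simp add: mV_def mW_def S_def)
  hence S: "S > 0" using K by (smt (verit) mult_nonneg_nonneg powr_ge_zero)
  have z: "z > 0" using prime_gt_0_nat[OF p] by (simp add: z_def)
  have fib: "wmass q t f g \<psi> \<theta> {(v, w) \<in> E. multiplicity p v \<in> I' \<and> multiplicity p w \<in> J'}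
      = (\<Sum>i\<in>I'. \<Sum>j\<in>J'. Sf i j)" if "I' \<subseteq> I" "J' \<subseteq> I" for I' J'
    unfolding Sf_def using that finI by (intro wmass_fibers finE) (auto intro: finite_subset)
  have mem: "multiplicity p v \<in> I" "multiplicity p w \<in> I" if "(v, w) \<in> E" for v w
    using that adm' by (auto simp: I_def)
  have "{(v, w) \<in> E. multiplicity p v \<in> I \<and> multiplicity p w \<in> I} = E" using mem by auto
  hence S_sum: "S = (\<Sum>i\<in>I. \<Sum>j\<in>I. Sf i j)" using fib[of I I] by (simp add: S_def)
  have Sf_le: "Sf i j \<le> K * (a i * b j) powr q * kern z i j" for i j
    unfolding a_def b_def z_def Sf_def using q t K
    by (intro mass_bound_fiber[OF f g p _ _ _ _ bound adm]) auto
  \<comment> \<open>If one side had no mass, every fiber bound would vanish, contradicting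
    \<open>S > 0\<close>.\<close>
  have m: "mV > 0" "mW > 0"
  proof -
    have "mV \<noteq> 0 \<and> mW \<noteq> 0"
    proof (rule ccontr)
      assume "\<not> ?thesis"
      hence "(\<forall>i\<in>I. a i = 0) \<or> (\<forall>i\<in>I. b i = 0)"
        using sums finI ab by (metis sum_nonneg_eq_0_iff)
      hence "S \<le> 0" unfolding S_sum using Sf_le
        by (intro sum_nonpos) (metis mult_zero_left mult_zero_right powr_zero_eq_one powr_0)
      thus False using S by simp
    qed
    thus "mV > 0" "mW > 0" using m0 by auto
  qed
  define x where "x = (\<lambda>i j. (a i / mV) powr q * (b j / mW) powr q * kern z i j)"
  have x0: "x i j \<ge> 0" for i j using z by (simp add: x_def kern_nonneg)
  have Sx: "Sf i j \<le> S * x i j" for i j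
  proof -
    have "K * (a i * b j) powr q * kern z i j = K * (mV * mW) powr q * x i j"
      using ab m by (simp add: x_def powr_mult powr_divide)
    also have "\<dots> \<le> S * x i j" using large' x0 by (intro mult_right_mono) auto
    finally show ?thesis using Sf_le[of i j] by simp
  qed
  have "S \<le> S * (\<Sum>i\<in>I. \<Sum>j\<in>I. x i j)"
    unfolding sum_distrib_left by (subst S_sum) (intro sum_mono Sx)
  hence "1 \<le> (\<Sum>i\<in>I. \<Sum>j\<in>I. x i j)" using S by simp
  moreover have "(\<Sum>i\<in>I. a i / mV) = 1" "(\<Sum>i\<in>I. b i / mW) = 1"
    using sums m by (auto simp flip: sum_divide_distrib)
  ultimately obtain k where k: "k \<in> I" and row: "(\<Sum>j\<in>I - {k}. x k j) \<le> C / p"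
    and col: "(\<Sum>i\<in>I - {k}. x i k) \<le> C / p"
    and both: "(\<Sum>i\<in>I - {k}. \<Sum>j\<in>I - {k}. x i j) \<le> C * p powr - (2 * q)"
    using conc[unfolded concentrates_def Let_def, rule_format, of I "\<lambda>i. a i / mV" "\<lambda>i. b i / mW"] finI ab m
    unfolding x_def z_def by (auto simp: Bex_def)
  \<comment> \<open>As 2 q > 1, double deviations are also covered by C / p; the three disjoint
    pieces below then give the constant \<open>3 * C\<close>.\<close>
  have pp: "p powr - (2 * q) \<le> 1 / real p"
  proof -
    have "real p powr - (2 * q) \<le> real p powr - 1"
      using q prime_ge_1_nat[OF p] by (intro powr_mono) auto
    thus ?thesis using prime_gt_0_nat[OF p] by (simp add: powr_minus_divide)
  qed
  let ?B = "{(v, w) \<in> E. multiplicity p v \<noteq> k \<and> multiplicity p w \<noteq> k}"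
  let ?R = "{(v, w) \<in> E. multiplicity p v = k \<and> multiplicity p w \<noteq> k}"
  let ?L = "{(v, w) \<in> E. multiplicity p v \<noteq> k \<and> multiplicity p w = k}"
  have B_eq: "?B = {(v, w) \<in> E. multiplicity p v \<in> I - {k} \<and> multiplicity p w \<in> I - {k}}" using mem by auto
  have "wmass q t f g \<psi> \<theta> ?B = (\<Sum>i\<in>I - {k}. \<Sum>j\<in>I - {k}. Sf i j)"
    unfolding B_eq by (rule fib) auto
  also have "\<dots> \<le> S * (\<Sum>i\<in>I - {k}. \<Sum>j\<in>I - {k}. x i j)"
    unfolding sum_distrib_left by (intro sum_mono Sx)
  also have "\<dots> \<le> S * (C * p powr - (2 * q))" using both S by simp
  finally have B: "wmass q t f g \<psi> \<theta> ?B \<le> C * p powr - (2 * q) * S" by (simp add: mult_ac)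
  have B': "wmass q t f g \<psi> \<theta> ?B \<le> S * (C / p)"
  proof -
    have "C * p powr - (2 * q) * S \<le> C * (1 / p) * S"
      using C S pp by (intro mult_right_mono mult_left_mono) auto
    thus ?thesis using B by (simp add: mult_ac)
  qed
  have R_eq: "?R = {(v, w) \<in> E. multiplicity p v \<in> {k} \<and> multiplicity p w \<in> I - {k}}" using mem by auto
  have "wmass q t f g \<psi> \<theta> ?R = (\<Sum>j\<in>I - {k}. Sf k j)"
    unfolding R_eq by (subst fib) (use k in auto)
  also have "\<dots> \<le> S * (\<Sum>j\<in>I - {k}. x k j)" unfolding sum_distrib_left by (intro sum_mono Sx)
  also have "\<dots> \<le> S * (C / p)" using row S by (intro mult_left_mono) auto
  finally have R: "wmass q t f g \<psi> \<theta> ?R \<le> S * (C / p)" .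
  have L_eq: "?L = {(v, w) \<in> E. multiplicity p v \<in> I - {k} \<and> multiplicity p w \<in> {k}}" using mem by auto
  have "wmass q t f g \<psi> \<theta> ?L = (\<Sum>i\<in>I - {k}. Sf i k)"
    unfolding L_eq by (subst fib) (use k in auto)
  also have "\<dots> \<le> S * (\<Sum>i\<in>I - {k}. x i k)" unfolding sum_distrib_left by (intro sum_mono Sx)
  also have "\<dots> \<le> S * (C / p)" using col S by (intro mult_left_mono) auto
  finally have L: "wmass q t f g \<psi> \<theta> ?L \<le> S * (C / p)" .
  have un: "{(v, w) \<in> E. multiplicity p v \<noteq> k \<or> multiplicity p w \<noteq> k} = (?B \<union> ?R) \<union> ?L" by auto
  have fin: "finite ?B" "finite ?R" "finite ?L" using finE by (auto intro: finite_subset[OF _ finE])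
  have "wmass q t f g \<psi> \<theta> {(v, w) \<in> E. multiplicity p v \<noteq> k \<or> multiplicity p w \<noteq> k}
      = wmass q t f g \<psi> \<theta> (?B \<union> ?R) + wmass q t f g \<psi> \<theta> ?L"
    unfolding un wmass_def using fin by (intro sum.union_disjoint) auto
  also have "wmass q t f g \<psi> \<theta> (?B \<union> ?R) = wmass q t f g \<psi> \<theta> ?B + wmass q t f g \<psi> \<theta> ?R"
    unfolding wmass_def using fin by (intro sum.union_disjoint) auto
  also have "wmass q t f g \<psi> \<theta> ?B + wmass q t f g \<psi> \<theta> ?R + wmass q t f g \<psi> \<theta> ?L
      \<le> S * (C / p) + S * (C / p) + S * (C / p)"
    by (intro add_mono B' R L)
  also have "\<dots> = 3 * C / p * S" by simp
  finally have "wmass q t f g \<psi> \<theta> {(v, w) \<in> E. multiplicity p v \<noteq> k \<or> multiplicity p w \<noteq> k}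
      \<le> 3 * C / p * S" .
  thus ?thesis using that[of k] B by (simp add: S_def)
qed

section \<open>Induction on the primes\<close>

text \<open>Over all integers from the ceiling of \<open>t\<close> on, 1/p^2 is compared with the
  telescoping difference 2/p - 2/(p + 1).\<close>

lemma sum_inverse_squares_le:
  fixes t :: real
  assumes "t \<ge> 1" "finite P" "\<And>p. p \<in> P \<Longrightarrow> real p \<ge> t"
  shows "(\<Sum>p\<in>P. t / (real p)\<^sup>2) \<le> 2"
proof -
  define m where "m = nat \<lceil>t\<rceil>"
  have m: "real m \<ge> t" "m \<ge> 1" using assms(1) by (auto simp: m_def le_nat_iff)
  obtain b where "\<forall>p\<in>P. p < b"
    using assms(2) finite_nat_set_iff_bounded by auto
  hence n: "max m b \<ge> m" "P \<subseteq> {m..<max m b}"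
    using assms by (auto simp: m_def nat_le_iff ceiling_le_iff)
  have le: "1 / (real p)\<^sup>2 \<le> (- 2 / real (Suc p)) - (- 2 / real p)" if "p \<ge> 1" for p
  proof -
    have "real p * real (Suc p) \<le> 2 * (real p)\<^sup>2"
      using that mult_left_mono[of 1 "real p" "real p"] by (simp add: power2_eq_square algebra_simps)
    hence "2 / (2 * (real p)\<^sup>2) \<le> 2 / (real p * real (Suc p))"
      using that by (intro divide_left_mono) auto
    hence "1 / (real p)\<^sup>2 \<le> 2 / (real p * real (Suc p))" by simp
    also have "\<dots> = (- 2 / real (Suc p)) - (- 2 / real p)"
      using that by (simp add: field_simps)
    finally show ?thesis .
  qed
  have "(\<Sum>p\<in>P. 1 / (real p)\<^sup>2) \<le> (\<Sum>p\<in>{m..<max m b}. 1 / (real p)\<^sup>2)"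
    using n by (intro sum_mono2) auto
  also have "\<dots> \<le> (\<Sum>p\<in>{m..<max m b}. (- 2 / real (Suc p)) - (- 2 / real p))"
    using m by (intro sum_mono le) auto
  also have "\<dots> = (- 2 / real (max m b)) - (- 2 / real m)"
    by (rule sum_Suc_diff') (rule n)
  also have "\<dots> \<le> 2 / t"
  proof -
    have "2 / real m \<le> 2 / t" using m assms(1) by (intro frac_le) auto
    moreover have "2 / real (max m b) \<ge> 0" by simp
    ultimately show ?thesis by (simp only: minus_divide_left[symmetric])
  qed
  finally have "t * (\<Sum>p\<in>P. 1 / (real p)\<^sup>2) \<le> t * (2 / t)"
    using assms(1) by (intro mult_left_mono) auto
  thus ?thesis using assms(1) by (simp add: sum_distrib_left)
qed

text \<open>At each prime one of the two minima with the valuation of \<open>N\<close> is that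
  valuation itself, and the other is the minimum of the valuations of \<open>v\<close> and
  \<open>w\<close>. The lemma turns edge bounds in terms of gcd(v, w) into bounds relative to
  \<open>N\<close>.\<close>

lemma gcd_mult_dvd_gcd_mult_gcd:
  fixes v w N :: nat
  assumes "v > 0" "w > 0" "N > 0"
    and "\<And>p. prime p \<Longrightarrow> multiplicity p v = multiplicity p N \<or> multiplicity p w = multiplicity p N"
  shows "gcd v w * N dvd gcd v N * gcd w N"
proof (rule multiplicity_le_imp_dvd)
  show "gcd v w * N \<noteq> 0" using assms by simp
  fix p :: nat assume p: "prime p"
  have "min (multiplicity p v) (multiplicity p w) + multiplicity p N
      \<le> min (multiplicity p v) (multiplicity p N) + min (multiplicity p w) (multiplicity p N)"
    using assms(4)[OF p] by auto
  thus "multiplicity p (gcd v w * N) \<le> multiplicity p (gcd v N * gcd w N)"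
    using assms(1-3) p by (simp add: prime_elem_multiplicity_mult_distrib multiplicity_gcd)
qed

section \<open>The case in which all primes are large\<close>

text \<open>If the bound fails, every prime has a dominant valuation. A quarter of the weighted mass
  at most is lost with the double deviations, and another quarter at most with edges of large
  weight. The unweighted mass T of the rest and M, the product of the two vertex masses, satisfy T
  <= M and T^2 <= 16 M, which is incompatible with T > 4 M^q.\<close>

lemma mass_bound_concentrated:
  assumes f: "nonneg_fun f" "multiplicative_fun f" "\<forall>n\<ge>1. one_conv f n \<le> real n"
    and g: "nonneg_fun g" "multiplicative_fun g" "\<forall>n\<ge>1. one_conv g n \<le> real n"
    and q: "1 / 2 < q" "q < 1" and t: "t \<ge> 1" and C: "C > 0" and K: "K \<ge> 8 * exp (24 * C)"
    and P: "finite P" "\<And>p. p \<in> P \<Longrightarrow> prime p"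
    and conc: "\<And>p. p \<in> P \<Longrightarrow> concentrates q C (real p)"
    and tail: "(\<Sum>p\<in>P. C * real p powr - (2 * q)) \<le> 1 / 4"
    and bound: "\<And>p. p \<in> P \<Longrightarrow> mass_bound q t f g (P - {p}) K"
  shows "mass_bound q t f g P K"
  unfolding mass_bound_def
proof (intro allI impI)
  fix \<psi> \<theta> V W E assume adm: "admissible P \<psi> \<theta> V W E"
  note adm' = adm[unfolded admissible_def]
  define M where "M = (\<Sum>v\<in>V. mu_pt f \<psi> v) * (\<Sum>w\<in>W. mu_pt g \<theta> w)"
  let ?S = "\<lambda>E. wmass q t f g \<psi> \<theta> E"
  have finE: "finite E" using adm' by (auto intro: finite_subset)
  have K0: "K > 0" using K by (smt (verit) exp_gt_zero)
  have M0: "M \<ge> 0"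
    unfolding M_def using adm' f g by (intro mult_nonneg_nonneg sum_nonneg mu_pt_nonneg) auto
  show "?S E \<le> K * ((\<Sum>v\<in>V. mu_pt f \<psi> v) * (\<Sum>w\<in>W. mu_pt g \<theta> w)) powr q"
    unfolding M_def[symmetric]
  proof (rule ccontr)
    assume "\<not> ?S E \<le> K * M powr q"
    hence large: "K * M powr q < ?S E" by simp
    have "\<exists>k. ?S {(v, w) \<in> E. multiplicity p v \<noteq> k \<or> multiplicity p w \<noteq> k} \<le> 3 * C / real p * ?S E \<and>
        ?S {(v, w) \<in> E. multiplicity p v \<noteq> k \<and> multiplicity p w \<noteq> k} \<le> C * real p powr - (2 * q) * ?S E"
      if "p \<in> P" for p
      by (rule exceptional_mass[OF f g P(2)[OF that] q _ _ conc[OF that] C bound[OF that] adm])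
        (use large t K0 in \<open>auto simp: M_def\<close>)
    hence "\<exists>k. \<forall>p\<in>P. ?S {(v, w) \<in> E. multiplicity p v \<noteq> k p \<or> multiplicity p w \<noteq> k p} \<le> 3 * C / real p * ?S E \<and>
        ?S {(v, w) \<in> E. multiplicity p v \<noteq> k p \<and> multiplicity p w \<noteq> k p} \<le> C * real p powr - (2 * q) * ?S E"
      by (intro bchoice ballI)
    then obtain k where k: "\<forall>p\<in>P. ?S {(v, w) \<in> E. multiplicity p v \<noteq> k p \<or> multiplicity p w \<noteq> k p} \<le> 3 * C / real p * ?S E \<and>
        ?S {(v, w) \<in> E. multiplicity p v \<noteq> k p \<and> multiplicity p w \<noteq> k p} \<le> C * real p powr - (2 * q) * ?S E"
      by (elim exE)
    note one = k[rule_format, THEN conjunct1] and two = k[rule_format, THEN conjunct2]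
    have S0: "?S E > 0" using large K0 by (smt (verit) mult_nonneg_nonneg powr_ge_zero)
    define bad where "bad = (\<lambda>p. {(v, w) \<in> E. multiplicity p v \<noteq> k p \<and> multiplicity p w \<noteq> k p})"
    define dev where "dev = (\<lambda>p. {(v, w) \<in> E. multiplicity p v \<noteq> k p \<or> multiplicity p w \<noteq> k p})"
    \<comment> \<open>On an edge this dominates \<open>t\<close> times the sum over
      \<open>dev_primes t v w\<close>, because two different valuations cannot both equal
      \<open>k p\<close>.\<close>
    define X where "X = (\<lambda>e. \<Sum>p\<in>P. if real p \<ge> t \<and> e \<in> dev p then t / real p else 0)"
    define E1 where "E1 = (\<Union>p\<in>P. bad p)"
    \<comment> \<open>The average of \<open>X\<close> over the weighted mass is at most 6 C: a
      proportion 3 C / p at each prime and \<open>sum_inverse_squares_le\<close>. By Markov's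
      inequality, four times this bound is exceeded on at most a quarter.\<close>
    define E2 where "E2 = {e \<in> E. X e > 24 * C}"
    define E' where "E' = E - E1 - E2"
    define m where "m = (\<lambda>(v, w). mu_pt f \<psi> v * mu_pt g \<theta> w * weight q t v w)"
    have Sm: "?S F = sum m F" for F by (simp add: wmass_def m_def)
    have m0: "m e \<ge> 0" if "e \<in> E" for e
      using that wmass_term_nonneg[OF f(1) g(1) adm] by (auto simp: m_def split: prod.splits)
    have E1: "?S E1 \<le> ?S E / 4"
    proof -
      have "sum m E1 \<le> (\<Sum>p\<in>P. sum m (bad p))"
      proof -
        have fin: "finite (bad p)" for p by (rule finite_subset[OF _ finE]) (auto simp: bad_def)
        have "sum m E1 \<le> (\<Sum>y\<in>Sigma P bad. m (snd y))"
        proof (rule sum_le_included[where i = snd])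
          show "finite E1" "finite (Sigma P bad)" using P fin by (auto simp: E1_def)
          show "\<forall>y\<in>Sigma P bad. 0 \<le> m (snd y)" using m0 by (auto simp: bad_def)
          show "\<forall>e\<in>E1. \<exists>y\<in>Sigma P bad. snd y = e \<and> m e \<le> m (snd y)"
            unfolding E1_def by force
        qed
        thus ?thesis using P fin by (simp add: sum.Sigma case_prod_unfold)
      qed
      also have "\<dots> \<le> (\<Sum>p\<in>P. C * real p powr - (2 * q) * ?S E)"
        using two by (intro sum_mono) (simp add: bad_def flip: Sm)
      also have "\<dots> = (\<Sum>p\<in>P. C * real p powr - (2 * q)) * ?S E"
        by (simp only: sum_distrib_right)
      also have "\<dots> \<le> 1 / 4 * ?S E"
        using tail S0 by (intro mult_right_mono) auto
      finally show ?thesis by (simp add: Sm)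
    qed
    have E2: "?S E2 \<le> ?S E / 4"
    proof -
      have dev_sub: "dev p \<subseteq> E" for p by (auto simp: dev_def)
      have "24 * C * sum m E2 \<le> (\<Sum>e\<in>E2. X e * m e)"
        unfolding sum_distrib_left using m0 by (intro sum_mono mult_right_mono) (auto simp: E2_def)
      also have "\<dots> \<le> (\<Sum>e\<in>E. X e * m e)"
        using finE m0 t by (intro sum_mono2) (auto simp: E2_def X_def intro!: mult_nonneg_nonneg sum_nonneg)
      also have "\<dots> = (\<Sum>p\<in>P. \<Sum>e\<in>E. (if real p \<ge> t \<and> e \<in> dev p then t / real p else 0) * m e)"
        unfolding X_def sum_distrib_right by (rule sum.swap)
      also have "\<dots> = (\<Sum>p\<in>P. if real p \<ge> t then t / real p * sum m (dev p) else 0)"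
      proof (intro sum.cong refl)
        fix p
        have "(\<Sum>e\<in>E. (if real p \<ge> t \<and> e \<in> dev p then t / real p else 0) * m e)
          = (\<Sum>e\<in>dev p. (if real p \<ge> t \<and> e \<in> dev p then t / real p else 0) * m e)"
          using finE dev_sub by (intro sum.mono_neutral_right) auto
        thus "(\<Sum>e\<in>E. (if real p \<ge> t \<and> e \<in> dev p then t / real p else 0) * m e)
          = (if real p \<ge> t then t / real p * sum m (dev p) else 0)"
          by (simp add: sum_distrib_left)
      qed
      also have "\<dots> \<le> (\<Sum>p\<in>P. if real p \<ge> t then t / (real p)\<^sup>2 * (3 * C * ?S E) else 0)"
      proof (intro sum_mono)
        fix p assume p: "p \<in> P"
        have "t / real p * sum m (dev p) \<le> t / real p * (3 * C / real p * ?S E)"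
          using one[OF p] t by (intro mult_left_mono) (auto simp: dev_def simp flip: Sm)
        thus "(if real p \<ge> t then t / real p * sum m (dev p) else 0)
            \<le> (if real p \<ge> t then t / (real p)\<^sup>2 * (3 * C * ?S E) else 0)"
          by (simp add: power2_eq_square)
      qed
      also have "\<dots> = (\<Sum>p | p \<in> P \<and> real p \<ge> t. t / (real p)\<^sup>2) * (3 * C * ?S E)"
        unfolding sum_distrib_right by (rule sum.inter_filter[OF P(1), symmetric])
      also have "\<dots> \<le> 2 * (3 * C * ?S E)"
        using t P C S0 by (intro mult_right_mono sum_inverse_squares_le) auto
      finally show ?thesis using C by (simp add: Sm)
    qed
    have E'_half: "?S E \<le> 2 * ?S E'"
    proof -
      have "E1 \<subseteq> E" "E2 \<subseteq> E" by (auto simp: E1_def E2_def bad_def)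
      hence "sum m E \<le> sum m (E1 \<union> E2) + sum m E'"
        unfolding E'_def using finE sum.subset_diff[of "E1 \<union> E2" E m] by (simp add: Diff_eq Int_assoc)
      moreover have "sum m (E1 \<union> E2) \<le> sum m E1 + sum m E2"
      proof -
        have "finite E1" "finite E2" using \<open>E1 \<subseteq> E\<close> \<open>E2 \<subseteq> E\<close> finE by (auto intro: finite_subset)
        moreover have "sum m (E1 \<inter> E2) \<ge> 0" using \<open>E1 \<subseteq> E\<close> m0 by (intro sum_nonneg) auto
        ultimately show ?thesis using sum_Un[of E1 E2 m] by linarith
      qed
      ultimately show ?thesis using E1 E2 by (simp add: Sm)
    qed
    define T where "T = (\<Sum>(v, w)\<in>E'. mu_pt f \<psi> v * mu_pt g \<theta> w)"
    have E'_sub: "E' \<subseteq> V \<times> W" using adm' by (auto simp: E'_def)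
    have \<mu>: "mu_pt f \<psi> v \<ge> 0" "mu_pt g \<theta> w \<ge> 0" if "v \<in> V" "w \<in> W" for v w
      using that adm' f g by (auto intro!: mu_pt_nonneg)
    have T: "?S E' \<le> exp (24 * C) * T"
      unfolding wmass_def T_def sum_distrib_left
    proof (intro sum_mono, clarify)
      fix v w assume e: "(v, w) \<in> E'"
      hence vw: "v \<in> V" "w \<in> W" "(v, w) \<in> E" using E'_sub by (auto simp: E'_def)
      have pos: "v > 0" "w > 0" "prime_factors v \<subseteq> P" "prime_factors w \<subseteq> P" using adm' vw by auto
      have "t * (\<Sum>p\<in>dev_primes t v w. 1 / real p) \<le> X (v, w)"
      proof -
        have "dev_primes t v w \<subseteq> prime_factors v \<union> prime_factors w"
          using pos by (auto simp: dev_primes_def prime_factors_multiplicity)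
        hence in_P: "dev_primes t v w \<subseteq> P" using pos by blast
        have "dev_primes t v w \<subseteq> {p \<in> P. real p \<ge> t \<and> (v, w) \<in> dev p}"
        proof
          fix p assume p: "p \<in> dev_primes t v w"
          hence "real p \<ge> t" "multiplicity p v \<noteq> multiplicity p w" by (auto simp: dev_primes_def)
          moreover from this(2) have "(v, w) \<in> dev p" using vw by (simp add: dev_def)
          ultimately show "p \<in> {p \<in> P. real p \<ge> t \<and> (v, w) \<in> dev p}" using p in_P by blast
        qed
        hence "(\<Sum>p\<in>dev_primes t v w. t / real p) \<le> (\<Sum>p | p \<in> P \<and> real p \<ge> t \<and> (v, w) \<in> dev p. t / real p)"
          using P t by (intro sum_mono2) auto
        thus ?thesis using P by (simp add: X_def sum_distrib_left sum.inter_filter)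
      qed
      also have "X (v, w) \<le> 24 * C" using e by (auto simp: E'_def E2_def)
      finally have tX: "t * (\<Sum>p\<in>dev_primes t v w. 1 / real p) \<le> 24 * C" .
      have "q * (t * (\<Sum>p\<in>dev_primes t v w. 1 / real p)) \<le> 1 * (24 * C)"
        by (rule mult_mono[OF _ tX]) (use q t C in \<open>auto intro!: mult_nonneg_nonneg sum_nonneg\<close>)
      hence "weight q t v w \<le> exp (24 * C)" by (simp add: weight_def mult.assoc)
      hence "(mu_pt f \<psi> v * mu_pt g \<theta> w) * weight q t v w \<le> (mu_pt f \<psi> v * mu_pt g \<theta> w) * exp (24 * C)"
        using \<mu>[OF vw(1,2)] by (intro mult_left_mono) auto
      thus "mu_pt f \<psi> v * mu_pt g \<theta> w * weight q t v w \<le> exp (24 * C) * (mu_pt f \<psi> v * mu_pt g \<theta> w)"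
        by (simp add: mult_ac)
    qed
    have T0: "T \<ge> 0" unfolding T_def using \<mu> E'_sub by (auto intro!: sum_nonneg)
    have "T \<le> (\<Sum>(v, w)\<in>V \<times> W. mu_pt f \<psi> v * mu_pt g \<theta> w)"
      unfolding T_def using E'_sub adm' \<mu> by (intro sum_mono2) auto
    hence TM: "T \<le> M" by (simp add: M_def sum_product sum.cartesian_product)
    \<comment> \<open>\<open>N\<close> has the dominant valuation at every prime of
      \<open>P\<close>. Off \<open>E1\<close> at least one endpoint agrees with \<open>N\<close> at
      each such prime; primes outside \<open>P\<close> divide neither the endpoints nor
      \<open>N\<close>.\<close>
    define N where "N = (\<Prod>p\<in>P. p ^ k p)"
    have N: "N > 0" unfolding N_def using P prime_gt_0_nat by (intro prod_pos) auto
    have multN: "multiplicity p N = (if p \<in> P then k p else 0)" if "prime p" for p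
      unfolding N_def using that P by (intro multiplicity_prod_prime_powers) auto
    have dvd: "gcd v w * N \<le> gcd v N * gcd w N" if "(v, w) \<in> E'" for v w
    proof -
      have vw: "v \<in> V" "w \<in> W" "(v, w) \<in> E" using that E'_sub by (auto simp: E'_def)
      have pos: "v > 0" "w > 0" "prime_factors v \<subseteq> P" using adm' vw by auto
      have "multiplicity p v = multiplicity p N \<or> multiplicity p w = multiplicity p N" if p: "prime p" for p
      proof (cases "p \<in> P")
        case True
        hence "(v, w) \<notin> bad p" using \<open>(v, w) \<in> E'\<close> by (auto simp: E'_def E1_def)
        thus ?thesis using vw True multN[OF p] by (auto simp: bad_def)
      next
        case False
        hence "multiplicity p v = 0" using pos p by (auto simp: prime_factors_multiplicity)
        thus ?thesis using False multN[OF p] by simp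
      qed
      hence "gcd v w * N dvd gcd v N * gcd w N"
        using pos N by (intro gcd_mult_dvd_gcd_mult_gcd) auto
      thus ?thesis using pos N by (intro dvd_imp_le) auto
    qed
    \<comment> \<open>Here \<open>y\<close> stands for \<open>\<psi> v\<close>, and, with the
      endpoints exchanged, for \<open>\<theta> w\<close>.\<close>
    have edge: "real (N div gcd v N) * real (w div gcd w N) * y \<le> 1"
      if "gcd v w * N \<le> gcd v N * gcd w N" "real w * y \<le> real (gcd v w)" "v > 0" "w > 0" for v w y
    proof -
      have "real (N div gcd v N) * real (w div gcd w N) * y = real N * (real w * y) / (real (gcd v N) * real (gcd w N))"
        by (simp add: real_of_nat_div)
      also have "\<dots> \<le> real N * real (gcd v w) / (real (gcd v N) * real (gcd w N))"
        using that by (intro divide_right_mono mult_left_mono) auto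
      also have "\<dots> \<le> 1"
      proof -
        have "real (gcd v w * N) \<le> real (gcd v N * gcd w N)" using that(1) by (rule of_nat_mono)
        thus ?thesis using that N by (simp add: divide_le_eq_1 mult_ac)
      qed
      finally show ?thesis .
    qed
    have E'E: "real w * \<psi> v \<le> real (gcd v w)" "real v * \<theta> w \<le> real (gcd v w)" "v > 0" "w > 0"
      if "(v, w) \<in> E'" for v w
      using that adm' by (auto simp: E'_def)
    have TM2: "T\<^sup>2 \<le> 16 * M"
      unfolding T_def M_def mult.assoc[symmetric]
    proof (rule edge_measure_square_le[OF f(1,3) g(1,3) _ _ _ _ _ _ E'_sub N])
      show "real (N div gcd v N) * real (w div gcd w N) * \<psi> v \<le> 1" if "(v, w) \<in> E'" for v w
        using edge[OF dvd[OF that]] E'E[OF that] by blast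
      show "real (N div gcd w N) * real (v div gcd v N) * \<theta> w \<le> 1" if "(v, w) \<in> E'" for v w
        using edge[of w v "\<theta> w"] dvd[OF that] E'E[OF that] by (simp add: gcd.commute mult.commute)
    qed (use adm' in auto)
    \<comment> \<open>The factor 2 comes from keeping half of the mass, the exponential from the
      weight; \<open>K \<ge> 8 * exp (24 * C)\<close> leaves a spare factor 4, whose square matches
      the 16 in \<open>TM2\<close>.\<close>
    have "K * M powr q < 2 * exp (24 * C) * T" using large E'_half T by simp
    also have "\<dots> \<le> K / 4 * T" using K T0 by (intro mult_right_mono) auto
    finally have key: "4 * M powr q < T" using K0 by simp
    \<comment> \<open>The trivial bound \<open>T \<le> M\<close> forces M > 1; then M^(2q) >= M
      contradicts the quadratic bound.\<close>
    have "M powr q < M" using key TM M0 by (smt (verit) powr_ge_zero)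
    hence M1: "M > 1" using q M0 powr_mono'[of q 1 M] by (cases "M > 1") auto
    have "(4 * M powr q)\<^sup>2 < 16 * M" using key TM2 by (smt (verit) power_strict_mono powr_ge_zero zero_less_numeral)
    hence "(M powr q)\<^sup>2 < M" by (simp add: power_mult_distrib)
    moreover have "(M powr q)\<^sup>2 = M powr (2 * q)" by (simp add: power2_eq_square flip: powr_add)
    moreover have "M powr 1 \<le> M powr (2 * q)" using M1 q by (intro powr_mono) auto
    ultimately show False using M1 by simp
  qed
qed

section \<open>Combining small and large primes\<close>

text \<open>A prime at most \<open>p0\<close> is removed at the cost of a factor 1000, which the
  cardinality in the exponent counts. Once no such prime is left, the constant is the same for
  \<open>P\<close> and for every \<open>P - {p}\<close>, as the argument for large primes
  requires.\<close>

lemma mass_bound_all: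
  assumes f: "nonneg_fun f" "multiplicative_fun f" "\<forall>n\<ge>1. one_conv f n \<le> real n"
    and g: "nonneg_fun g" "multiplicative_fun g" "\<forall>n\<ge>1. one_conv g n \<le> real n"
    and q: "1 / 2 < q" "q \<le> 9 / 10" and t: "t \<ge> 1" and C: "C > 0"
    and p0: "p0 \<ge> 0" "24 * C + 7 \<le> p0"
    and conc: "\<And>p. p \<ge> p0 \<Longrightarrow> concentrates q C p"
    and tail: "\<And>P. finite P \<Longrightarrow> (\<And>p. p \<in> P \<Longrightarrow> real p \<ge> p0) \<Longrightarrow> (\<Sum>p\<in>P. C * real p powr - (2 * q)) \<le> 1 / 4"
    and P: "finite P" "\<And>p. p \<in> P \<Longrightarrow> prime p"
  shows "mass_bound q t f g P (1000 powr (p0 + real (card {p \<in> P. real p \<le> p0})))"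
  using P
proof (induction "card P" arbitrary: P rule: less_induct)
  case less
  have IH: "mass_bound q t f g (P - {p}) (1000 powr (p0 + real (card {p' \<in> P - {p}. real p' \<le> p0})))"
    if "p \<in> P" for p
    using less.prems that by (intro less.hyps card_Diff1_less) auto
  show ?case
  proof (cases "\<exists>p\<in>P. real p \<le> p0")
    case True
    then obtain p where p: "p \<in> P" "real p \<le> p0" by blast
    have "{p' \<in> P - {p}. real p' \<le> p0} = {p' \<in> P. real p' \<le> p0} - {p}" by auto
    moreover have "card {p' \<in> P. real p' \<le> p0} = Suc (card ({p' \<in> P. real p' \<le> p0} - {p}))"
      using p less.prems by (intro card.remove) auto
    ultimately have "(1000::real) powr (p0 + real (card {p' \<in> P. real p' \<le> p0}))
        = 1000 * 1000 powr (p0 + real (card {p' \<in> P - {p}. real p' \<le> p0}))"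
      by (simp add: powr_add)
    thus ?thesis
      using mass_bound_add_prime[OF f g less.prems(2)[OF p(1)] _ q(2) _ _ IH[OF p(1)]] q t by simp
  next
    case False
    hence eq: "{p' \<in> P. real p' \<le> p0} = {}" "{p' \<in> P - {p}. real p' \<le> p0} = {}" for p by auto
    have gt: "real p \<ge> p0" if "p \<in> P" for p using False that by auto
    \<comment> \<open>From 8 <= exp 7 and e <= 1000, the condition
      \<open>24 * C + 7 \<le> p0\<close> makes \<open>1000 powr p0\<close> large enough.\<close>
    have K: "8 * exp (24 * C) \<le> 1000 powr p0"
    proof -
      have "8 * exp (24 * C) \<le> exp 7 * exp (24 * C)"
        using exp_ge_add_one_self[of 7] by (intro mult_right_mono) auto
      also have "\<dots> \<le> exp p0" using p0 by (simp flip: exp_add)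
      also have "\<dots> = exp 1 powr p0" by (simp add: powr_def)
      also have "\<dots> \<le> 1000 powr p0" using exp_le p0 by (intro powr_mono2) auto
      finally show ?thesis .
    qed
    have "mass_bound q t f g P (1000 powr p0)"
    proof (rule mass_bound_concentrated[OF f g q(1) _ t C K])
      show "concentrates q C (real p)" if "p \<in> P" for p using conc gt that by blast
      show "mass_bound q t f g (P - {p}) (1000 powr p0)" if "p \<in> P" for p
        using IH[OF that] unfolding eq by simp
      show "(\<Sum>p\<in>P. C * real p powr - (2 * q)) \<le> 1 / 4" using tail gt less.prems(1) by blast
    qed (use q less.prems in auto)
    thus ?thesis by (simp add: eq)
  qed
qed

section \<open>Edge conditions in terms of valuations\<close>

text \<open>The quotient is a product of two coprime cofactors. A prime divides at most one of them,
  so it divides the product exactly when its valuations in the cofactors differ; the gcd shifts both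
  valuations equally.\<close>

lemma dvd_div_gcd_square_iff:
  fixes p v w :: nat
  assumes p: "prime p" and pos: "v > 0" "w > 0"
  shows "p dvd (v * w) div (gcd v w)\<^sup>2 \<longleftrightarrow> multiplicity p v \<noteq> multiplicity p w"
proof -
  define d where "d = gcd v w"
  have d: "d > 0" using pos by (simp add: d_def)
  obtain a b where ab: "v = a * d" "w = b * d" "coprime a b"
    unfolding d_def using pos by (metis gcd_coprime_exists gcd_eq_0_iff less_numeral_extra(3))
  have ab0: "a > 0" "b > 0" using ab pos by (auto intro: Nat.gr0I)
  have "(v * w) div d\<^sup>2 = a * b"
    using d by (simp add: ab power2_eq_square div_mult_self_is_m ac_simps)
  moreover have "multiplicity p v = multiplicity p a + multiplicity p d"
    "multiplicity p w = multiplicity p b + multiplicity p d"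
    using p ab ab0 d by (auto simp: prime_elem_multiplicity_mult_distrib)
  moreover have "p dvd a * b \<longleftrightarrow> multiplicity p a \<noteq> multiplicity p b"
  proof -
    have "\<not> (p dvd a \<and> p dvd b)" using ab(3) p by (meson coprime_common_divisor not_prime_unit)
    moreover have "multiplicity p a = 0 \<longleftrightarrow> \<not> p dvd a" "multiplicity p b = 0 \<longleftrightarrow> \<not> p dvd b"
      using prime_multiplicity_gt_zero_iff[of p a] prime_multiplicity_gt_zero_iff[of p b] p ab0 by auto
    ultimately show ?thesis using p by (metis prime_dvd_mult_iff)
  qed
  ultimately show ?thesis by (simp add: d_def)
qed

lemma edge_setD:
  assumes "(v, w) \<in> edge_set \<psi> \<theta> t C"
  shows "v \<in> pos_supp \<psi>" "w \<in> pos_supp \<theta>" "real w * \<psi> v \<le> real (gcd v w)" "real v * \<theta> w \<le> real (gcd v w)"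
    "C \<le> (\<Sum>p\<in>dev_primes t v w. 1 / real p)"
proof -
  show vw: "v \<in> pos_supp \<psi>" "w \<in> pos_supp \<theta>" using assms by (auto simp: edge_set_def)
  hence pos: "v > 0" "w > 0" by (auto simp: pos_supp_def)
  have "D \<psi> \<theta> v w \<le> 1" using assms by (auto simp: edge_set_def)
  thus "real w * \<psi> v \<le> real (gcd v w)" "real v * \<theta> w \<le> real (gcd v w)"
    using pos by (auto simp: D_def divide_le_eq_1)
  have "dev_primes t v w = {p. prime p \<and> p dvd (v * w) div (gcd v w)\<^sup>2 \<and> real p \<ge> t}"
    using dvd_div_gcd_square_iff[OF _ pos] by (auto simp: dev_primes_def)
  thus "C \<le> (\<Sum>p\<in>dev_primes t v w. 1 / real p)"
    using assms by (auto simp: edge_set_def)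
qed

section \<open>Choice of \<open>p0\<close> and removal of the weight\<close>

theorem theorem1p7:
  fixes \<epsilon> :: real
  assumes "0 < \<epsilon>" and "\<epsilon> \<le> 2 / 5"
  shows "\<exists>p0::real. p0 > 0 \<and>
    (\<forall>(\<psi> :: nat \<Rightarrow> real) (\<theta> :: nat \<Rightarrow> real) (f :: nat \<Rightarrow> real) (g :: nat \<Rightarrow> real)
      (t :: real) (C :: real) (V :: nat set) (W :: nat set) (E :: (nat \<times> nat) set).
        nonneg_fun \<psi> \<longrightarrow> finite (pos_supp \<psi>) \<longrightarrow>
        nonneg_fun \<theta> \<longrightarrow> finite (pos_supp \<theta>) \<longrightarrow>
        nonneg_fun f \<longrightarrow> multiplicative_fun f \<longrightarrow> (\<forall>n\<ge>1. one_conv f n \<le> real n) \<longrightarrow>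
        nonneg_fun g \<longrightarrow> multiplicative_fun g \<longrightarrow> (\<forall>n\<ge>1. one_conv g n \<le> real n) \<longrightarrow>
        t \<ge> 1 \<longrightarrow>
        V \<subseteq> pos_supp \<psi> \<longrightarrow> W \<subseteq> pos_supp \<theta> \<longrightarrow>
        E \<subseteq> edge_set \<psi> \<theta> t C \<inter> (V \<times> W) \<longrightarrow>
        mu2 f g \<psi> \<theta> E \<le>
          1000 powr (P_exp \<psi> \<theta> p0) *
          (mu f \<psi> V * mu g \<theta> W * exp (- C * t)) powr (1 / 2 + \<epsilon>))"
proof -
  define q where "q = 1 / 2 + \<epsilon>"
  have q: "1 / 2 < q" "q \<le> 9 / 10" using assms by (auto simp: q_def)
  obtain p1 A where p1: "p1 \<ge> 1" and A: "A > 0" and conc: "\<And>p. p \<ge> p1 \<Longrightarrow> concentrates q A p"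
    using concentration[of q] q by auto
  \<comment> \<open>The series converges because 2 q > 1. The Cauchy criterion then bounds the sum
    over any finite set of integers beyond \<open>n0\<close>, which limits the total proportion of
    double deviations.\<close>
  have "summable (\<lambda>n. A * real n powr - (2 * q))"
    using q by (intro summable_mult) (simp add: summable_real_powr_iff)
  then obtain n0 where n0: "\<And>m n. m \<ge> n0 \<Longrightarrow> norm (\<Sum>k=m..n. A * real k powr - (2 * q)) < 1 / 4"
    by (rule summable_partial_sum_bound[of _ "1 / 4"]) auto
  have tail: "(\<Sum>p\<in>P. A * real p powr - (2 * q)) \<le> 1 / 4"
    if P: "finite P" "\<And>p. p \<in> P \<Longrightarrow> p \<ge> n0" for P
  proof -
    obtain b where b: "\<forall>p\<in>P. p \<le> b" using P(1) finite_nat_set_iff_bounded_le by auto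
    have "(\<Sum>p\<in>P. A * real p powr - (2 * q)) \<le> (\<Sum>p=n0..b. A * real p powr - (2 * q))"
      using P b A by (intro sum_mono2) auto
    also have "\<dots> \<le> 1 / 4" using n0[of n0 b] by (simp add: abs_less_iff)
    finally show ?thesis .
  qed
  \<comment> \<open>Beyond \<open>p1\<close> there is concentration, beyond \<open>n0\<close> the
    tail is small, and the last entry makes \<open>1000 powr p0\<close> at least 8 exp(24
    A).\<close>
  define p0 where "p0 = max (max p1 (real n0)) (24 * A + 7)"
  show ?thesis
  proof (intro exI[of _ p0] conjI allI impI)
    show "p0 > 0" using p1 by (simp add: p0_def)
    fix \<psi> \<theta> f g :: "nat \<Rightarrow> real" and t C :: real and V W :: "nat set" and E :: "(nat \<times> nat) set"
    assume \<psi>: "nonneg_fun \<psi>" "finite (pos_supp \<psi>)" and \<theta>: "nonneg_fun \<theta>" "finite (pos_supp \<theta>)"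
      and f: "nonneg_fun f" "multiplicative_fun f" "\<forall>n\<ge>1. one_conv f n \<le> real n"
      and g: "nonneg_fun g" "multiplicative_fun g" "\<forall>n\<ge>1. one_conv g n \<le> real n"
      and t: "t \<ge> 1" and V: "V \<subseteq> pos_supp \<psi>" and W: "W \<subseteq> pos_supp \<theta>"
      and E: "E \<subseteq> edge_set \<psi> \<theta> t C \<inter> (V \<times> W)"
    have fin: "finite V" "finite W" using V W \<psi> \<theta> by (auto intro: finite_subset)
    have finE: "finite E" using E fin by (auto intro: finite_subset)
    have mu2: "mu2 f g \<psi> \<theta> E = (\<Sum>(v, w)\<in>E. mu_pt f \<psi> v * mu_pt g \<theta> w)"
      using finE by (simp add: mu2_def)
    have mu: "mu f \<psi> V = (\<Sum>v\<in>V. mu_pt f \<psi> v)" "mu g \<theta> W = (\<Sum>w\<in>W. mu_pt g \<theta> w)"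
      using fin by (simp_all add: mu_def)
    have pos: "v > 0" "w > 0" if "v \<in> V" "w \<in> W" for v w
      using that V W by (auto simp: pos_supp_def)
    have nn: "mu_pt f \<psi> v \<ge> 0" "mu_pt g \<theta> w \<ge> 0" if "v \<in> V" "w \<in> W" for v w
      using pos[OF that] f g \<psi> \<theta> by (auto intro: mu_pt_nonneg)
    show "mu2 f g \<psi> \<theta> E \<le> 1000 powr (P_exp \<psi> \<theta> p0) *
        (mu f \<psi> V * mu g \<theta> W * exp (- C * t)) powr (1 / 2 + \<epsilon>)"
    proof (cases "E = {}")
      case True
      thus ?thesis unfolding mu2 by simp
    next
      case False
      then obtain e where "e \<in> E" by blast
      hence "e \<in> V \<times> W" using E by blast
      \<comment> \<open>Membership in \<open>prime_set\<close> needs a vertex from each support, so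
        one on each side is fixed; it accompanies any vertex of the other side.\<close>
      then obtain v0 w0 where vw0: "v0 \<in> V" "w0 \<in> W" by blast
      let ?P = "prime_set \<psi> \<theta>"
      have P: "finite ?P" "\<And>p. p \<in> ?P \<Longrightarrow> prime p"
      proof -
        have "?P \<subseteq> (\<Union>v\<in>pos_supp \<psi> \<union> pos_supp \<theta>. prime_factors v)"
        proof
          fix p assume "p \<in> ?P"
          then obtain v w where p: "prime p" "v \<in> pos_supp \<psi>" "w \<in> pos_supp \<theta>" "p dvd v * w"
            by (auto simp: prime_set_def)
          hence "v \<noteq> 0" "w \<noteq> 0" by (auto simp: pos_supp_def)
          with p have "p \<in> prime_factors v \<or> p \<in> prime_factors w"
            by (simp add: in_prime_factors_iff prime_dvd_mult_iff)
          thus "p \<in> (\<Union>v\<in>pos_supp \<psi> \<union> pos_supp \<theta>. prime_factors v)" using p by blast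
        qed
        thus "finite ?P" by (rule finite_subset) (use \<psi> \<theta> in auto)
      qed (auto simp: prime_set_def)
      have adm: "admissible ?P \<psi> \<theta> V W E"
        unfolding admissible_def
      proof (intro conjI fin \<psi> \<theta> ballI)
        show "E \<subseteq> V \<times> W" using E by auto
        fix v assume v: "v \<in> V \<union> W"
        show "v > 0" using v V W by (auto simp: pos_supp_def)
        show "prime_factors v \<subseteq> ?P"
        proof
          fix p assume p: "p \<in> prime_factors v"
          show "p \<in> ?P"
          proof (cases "v \<in> V")
            case True
            hence "(v, w0) \<in> pos_supp \<psi> \<times> pos_supp \<theta>" "p dvd v * w0" using vw0 V W p by auto
            thus ?thesis using p by (auto simp: prime_set_def)
          next
            case False
            hence "(v0, v) \<in> pos_supp \<psi> \<times> pos_supp \<theta>" "p dvd v0 * v" using vw0 V W p v by auto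
            thus ?thesis using p by (auto simp: prime_set_def)
          qed
        qed
      next
        fix e assume "e \<in> E"
        moreover obtain v w where e: "e = (v, w)" by (cases e)
        ultimately have "(v, w) \<in> edge_set \<psi> \<theta> t C" using E by blast
        from edge_setD(3,4)[OF this]
        show "case e of (v, w) \<Rightarrow> real w * \<psi> v \<le> real (gcd v w) \<and> real v * \<theta> w \<le> real (gcd v w)"
          by (simp add: e)
      qed
      define M where "M = mu f \<psi> V * mu g \<theta> W"
      have M0: "M \<ge> 0"
        unfolding M_def mu using nn vw0 by (intro mult_nonneg_nonneg sum_nonneg) auto
      have "mass_bound q t f g ?P (1000 powr (p0 + real (card {p \<in> ?P. real p \<le> p0})))"
        using q t A p1 P by (intro mass_bound_all[OF f g, where C = A] conc tail) (auto simp: p0_def)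
      moreover have "{p \<in> ?P. real p \<le> p0} = {p \<in> ?P. 1 \<le> real p \<and> real p \<le> p0}"
        using prime_ge_1_nat[OF P(2)] by auto
      ultimately have bound: "wmass q t f g \<psi> \<theta> E \<le> 1000 powr (P_exp \<psi> \<theta> p0) * M powr q"
        using adm unfolding mass_bound_def P_exp_def M_def mu by auto
      \<comment> \<open>Chernoff's argument, term by term: every edge has weight at least exp(q C
        t).\<close>
      have "exp (q * C * t) * mu2 f g \<psi> \<theta> E \<le> wmass q t f g \<psi> \<theta> E"
        unfolding mu2 wmass_def sum_distrib_left
      proof (intro sum_mono, clarify)
        fix v w assume e: "(v, w) \<in> E"
        have vw: "v \<in> V" "w \<in> W" using e E by auto
        have "C \<le> (\<Sum>p\<in>dev_primes t v w. 1 / real p)"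
          using e E by (auto intro: edge_setD(5))
        hence "q * t * C \<le> q * t * (\<Sum>p\<in>dev_primes t v w. 1 / real p)"
          using q t by (intro mult_left_mono) auto
        hence "exp (q * C * t) \<le> weight q t v w" by (simp add: weight_def mult_ac)
        hence "exp (q * C * t) * (mu_pt f \<psi> v * mu_pt g \<theta> w) \<le> weight q t v w * (mu_pt f \<psi> v * mu_pt g \<theta> w)"
          using nn[OF vw] by (intro mult_right_mono) auto
        thus "exp (q * C * t) * (mu_pt f \<psi> v * mu_pt g \<theta> w) \<le> mu_pt f \<psi> v * mu_pt g \<theta> w * weight q t v w"
          by (simp add: mult_ac)
      qed
      hence "exp (q * C * t) * mu2 f g \<psi> \<theta> E \<le> 1000 powr (P_exp \<psi> \<theta> p0) * M powr q"
        using bound by linarith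
      hence "exp (- (q * C * t)) * (exp (q * C * t) * mu2 f g \<psi> \<theta> E)
          \<le> exp (- (q * C * t)) * (1000 powr (P_exp \<psi> \<theta> p0) * M powr q)"
        by (intro mult_left_mono) auto
      moreover have "exp (- (q * C * t)) * (exp (q * C * t) * mu2 f g \<psi> \<theta> E) = mu2 f g \<psi> \<theta> E"
        by (simp add: mult.assoc[symmetric] flip: exp_add)
      \<comment> \<open>The factor exp(- q C t) is exactly the q-th power of exp(- C t), so it can
        be moved inside the power.\<close>
      moreover have "(M * exp (- C * t)) powr q = M powr q * exp (- (q * C * t))"
        using M0 by (simp add: powr_mult exp_powr_real mult_ac)
      ultimately have "mu2 f g \<psi> \<theta> E \<le> 1000 powr (P_exp \<psi> \<theta> p0) * (M * exp (- C * t)) powr q"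
        by (simp only: mult_ac)
      thus ?thesis by (simp only: M_def q_def)
    qed
  qed
qed

end
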